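(* Let $a\ge 1$, $b\ge 0$ be integers and let $\nu=NE^{\nu_1}NE^{\nu_2}\cdots NE^{\nu_a}$ be a lattice path from $(0,0)$ to $(b,a)$. The normalized volume of the flow polytope $\mathcal{F}_{\mathrm{car}(\nu)}$ is equal to the number of $\nu$-Dyck paths, that is, the $\nu$-Catalan number $\mathrm{Cat}(\nu)$.
   Context: Lattice paths use north steps $N=(0,1)$ and east steps $E=(1,0)$. Here $\nu=NE^{\nu_1}\cdots NE^{\nu_a}$ with integers $\nu_i\ge 0$ and $\sum_i \nu_i=b$. A $\nu$-Dyck path is a lattice path (with $N$ and $E$ steps) from $(0,0)$ to $(b,a)$ that lies weakly above $\nu$; $\mathrm{Cat}(\nu)$ denotes the number of $\nu$-Dyck paths. The $\nu$-caracol graph $\mathrm{car}(\nu)$ is the directed multigraph on the vertex set $\{1,\dots,a+3\}$, all edges $(i,j)$ directed from $i$ to $j$ with $i<j$, having exactly these edges: $\nu_i$ copies of $(1,i+2)$ for $i=1,\dots,a$; one edge $(i,a+3)$ for each $i=2,\dots,a+1$; and one edge $(i,i+1)$ for each $i=1,\dots,a+2$. It has $m=2a+b+2$ edges; write $n+1=a+3$. The flow polytope $\mathcal{F}_{\mathrm{car}(\nu)}\subset\mathbb{R}^m$ (with unitary net flow $\mathbf{e}_1-\mathbf{e}_{n+1}$) is the set of tuples $(x_e)_e$ of nonnegative reals indexed by the edges such that $\sum_{e\in \mathrm{out}(1)}x_e=1$ and $\sum_{e\in\mathrm{out}(j)}x_e-\sum_{e\in\mathrm{in}(j)}x_e=0$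 for $j=2,\dots,n$, where $\mathrm{in}(j)$ and $\mathrm{out}(j)$ are the sets of incoming and outgoing edges at $j$. Its dimension is $d=a+b$. The normalized volume of a $d$-dimensional lattice polytope $P\subset\mathbb{R}^m$ is $d!$ times its $d$-dimensional volume, measured relative to the lattice $\mathrm{aff}(P)\cap\mathbb{Z}^m$, so that a unimodular simplex has normalized volume $1$. *)

theory Defs
  imports "HOL-Analysis.Analysis" "HOL-Analysis.Finite_Function_Topology" "Graph_Theory.Digraph"
begin

section \<open>Lattice paths\<close>

datatype step = North | East

type_synonym lattice_path = "step list"

text \<open>All lattice paths start at the origin; points are pairs (abscissa, ordinate).\<close>

definition endpoint :: "lattice_path \<Rightarrow> nat \<times> nat" where
  "endpoint p = (count_list p East, count_list p North)"

definition path_points :: "lattice_path \<Rightarrow> (nat \<times> nat) set" where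
  "path_points p = {endpoint (take k p) | k. k \<le> length p}"

text \<open>
  No lattice point of the path lies strictly below the other path: on its vertical line there is
  a point of the other path at the same height or lower. As steps are unit steps, comparing
  lattice points suffices.
\<close>

definition weakly_above :: "lattice_path \<Rightarrow> lattice_path \<Rightarrow> bool" where
  "weakly_above p q \<longleftrightarrow> (\<forall>(x, y) \<in> path_points p. \<exists>y'. (x, y') \<in> path_points q \<and> y' \<le> y)"

definition Dyck_paths :: "lattice_path \<Rightarrow> lattice_path set" where
  "Dyck_paths q = {p. endpoint p = endpoint q \<and> weakly_above p q}"

definition Cat :: "lattice_path \<Rightarrow> nat" where
  "Cat q = card (Dyck_paths q)"

text \<open>The path $N E^{\nu_1} \cdots N E^{\nu_a}$; only the values of \<open>\<nu>\<close> on $1, \ldots, a$ matter.\<close>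

definition path_of :: "nat \<Rightarrow> (nat \<Rightarrow> nat) \<Rightarrow> lattice_path" where
  "path_of a \<nu> = concat (map (\<lambda>i. North # replicate (\<nu> i) East) [1..<a + 1])"


section \<open>The caracol graph\<close>

text \<open>
  An arc is a triple (tail, head, copy number), the last entry distinguishing parallel arcs.
  The three families below have pairwise disjoint sets of (tail, head) pairs, so the union
  does not identify any arcs.
\<close>

type_synonym arc = "nat \<times> nat \<times> nat"

definition car :: "nat \<Rightarrow> (nat \<Rightarrow> nat) \<Rightarrow> (nat, arc) pre_digraph" where
  "car a \<nu> =
    \<lparr> verts = {1..a + 3},
      arcs = {(1, i + 2, k) | i k. i \<in> {1..a} \<and> k < \<nu> i}
           \<union> {(i, a + 3, 0) | i. i \<in> {2..a + 1}}
           \<union> {(i, i + 1, 0) | i. i \<in> {1..a + 2}},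
      tail = (\<lambda>(i, j, k). i),
      head = (\<lambda>(i, j, k). j) \<rparr>"

lemma fin_digraph_car: "fin_digraph (car a \<nu>)"
proof
  let ?A = "{(1::nat, i + 2, k) | i k. i \<in> {1..a} \<and> k < \<nu> i}"
  have "?A = (\<lambda>(i, k). (1, i + 2, k)) ` (SIGMA i:{1..a}. {..<\<nu> i})"
    by (auto simp: image_iff)
  moreover have "finite ((\<lambda>(i, k). (1::nat, i + 2, k)) ` (SIGMA i:{1..a}. {..<\<nu> i}))"
    by (intro finite_imageI finite_SigmaI) auto
  ultimately have "finite ?A"
    by (simp only:)
  then show "finite (arcs (car a \<nu>))"
    by (simp add: car_def)
qed (auto simp: car_def)

lemma card_arcs_car: "card (arcs (car a \<nu>)) = 2 * a + (\<Sum>i = 1..a. \<nu> i) + 2"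
proof -
  let ?A = "{(1::nat, i + 2, k) | i k. i \<in> {1..a} \<and> k < \<nu> i}"
  let ?B = "{(i, a + 3, 0::nat) | i. i \<in> {2..a + 1}}"
  let ?C = "{(i, i + 1, 0::nat) | i. i \<in> {1..a + 2}}"
  have A: "?A = (\<lambda>(i, k). (1, i + 2, k)) ` (SIGMA i:{1..a}. {..<\<nu> i})"
    by (auto simp: image_iff)
  have B: "?B = (\<lambda>i. (i, a + 3, 0)) ` {2..a + 1}" and C: "?C = (\<lambda>i. (i, i + 1, 0)) ` {1..a + 2}"
    by auto
  have cA: "card ?A = (\<Sum>i = 1..a. \<nu> i)"
    unfolding A by (subst card_image) (auto simp: inj_on_def)
  have cB: "card ?B = a"
    unfolding B by (subst card_image) (auto simp: inj_on_def)
  have cC: "card ?C = a + 2"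
    unfolding C by (subst card_image) (auto simp: inj_on_def)
  have fin: "finite ?A" "finite ?B" "finite ?C"
    unfolding A B C by (intro finite_imageI finite_SigmaI; simp)+
  have disj: "?A \<inter> ?B = {}" "(?A \<union> ?B) \<inter> ?C = {}"
    by auto
  have "card (?A \<union> ?B \<union> ?C) = (\<Sum>i = 1..a. \<nu> i) + a + (a + 2)"
    using fin disj cA cB cC by (simp add: card_Un_disjoint)
  then show ?thesis
    by (simp add: car_def)
qed


section \<open>Flow polytopes\<close>

text \<open>
  For a digraph with vertices $1, \ldots, n + 1$ and arc set $A$ of size $m$, the space
  $\mathbb{R}^m$ is the set of finitely supported functions with support in $A$.
\<close>

definition flow_polytope :: "nat \<Rightarrow> (nat, 'e) pre_digraph \<Rightarrow> ('e \<Rightarrow>\<^sub>0 real) set" where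
  "flow_polytope n G =
    {x. Poly_Mapping.keys x \<subseteq> arcs G
      \<and> (\<forall>e \<in> arcs G. 0 \<le> Poly_Mapping.lookup x e)
      \<and> (\<Sum>e \<in> out_arcs G 1. Poly_Mapping.lookup x e) = 1
      \<and> (\<forall>j \<in> {2..n}. (\<Sum>e \<in> out_arcs G j. Poly_Mapping.lookup x e)
                     - (\<Sum>e \<in> in_arcs G j. Poly_Mapping.lookup x e) = 0)}"


section \<open>Normalized volume\<close>

text \<open>The library's \<open>aff_dim\<close> is only available on Euclidean spaces.\<close>

definition affine_dimension :: "'a::real_vector set \<Rightarrow> nat" where
  "affine_dimension P = dim {x - y | x y. x \<in> P \<and> y \<in> P}"

definition integer_lattice :: "('e \<Rightarrow>\<^sub>0 real) set" where
  "integer_lattice = {x. \<forall>e. Poly_Mapping.lookup x e \<in> \<int>}"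

definition affine_chart :: "nat \<Rightarrow> 'a::real_vector \<Rightarrow> (nat \<Rightarrow> 'a) \<Rightarrow> (nat \<Rightarrow> real) \<Rightarrow> 'a" where
  "affine_chart d p v t = p + (\<Sum>i<d. t i *\<^sub>R v i)"

text \<open>
  The origin \<open>p\<close> and the vectors \<open>v 0, \<dots>, v (d - 1)\<close> identify $\mathbb{R}^d$ with
  the affine hull of \<open>P\<close> so that $\mathbb{Z}^d$ corresponds to the integer points of that hull.
\<close>

definition lattice_frame ::
    "('e \<Rightarrow>\<^sub>0 real) set \<Rightarrow> nat \<Rightarrow> ('e \<Rightarrow>\<^sub>0 real) \<Rightarrow> (nat \<Rightarrow> 'e \<Rightarrow>\<^sub>0 real) \<Rightarrow> bool" where
  "lattice_frame P d p v \<longleftrightarrow>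
     bij_betw (affine_chart d p v) ({..<d} \<rightarrow>\<^sub>E UNIV) (affine hull P)
     \<and> affine_chart d p v ` ({..<d} \<rightarrow>\<^sub>E \<int>) = affine hull P \<inter> integer_lattice"

text \<open>
  Lebesgue measure on $\mathbb{R}^d$ is transported to the affine hull along some lattice frame.
  Two frames differ by an affine map with linear part in $GL_d(\mathbb{Z})$, so the choice
  is immaterial. A frame exists for every nonempty lattice polytope; otherwise the value
  is meaningless.
\<close>

definition normalized_volume :: "('e \<Rightarrow>\<^sub>0 real) set \<Rightarrow> real" where
  "normalized_volume P =
    (let d = affine_dimension P;
         (p, v) = (SOME (p, v). lattice_frame P d p v)
     in fact d * measure (\<Pi>\<^sub>M i \<in> {..<d}. lborel)
                   {t \<in> {..<d} \<rightarrow>\<^sub>E UNIV. affine_chart d p v t \<in> P})"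

end

theory Submission
  imports Defs
begin

text \<open>
  Let \<open>N k = \<nu>\<^sub>1 + \<dots> + \<nu>\<^sub>k\<close>. A flow on the caracol graph is determined by its values
  \<open>y\<^sub>1, \<dots>, y\<^sub>a\<close> on the arcs from \<open>2, \<dots>, a + 1\<close> to the sink and \<open>x\<^sub>1, \<dots>, x\<^sub>b\<close> on the
  arcs from the source other than the one to \<open>2\<close>, taken in the order of their heads, so that
  \<open>x\<^sub>r\<close> belongs to the \<open>r\<close>-th east step of \<open>\<nu>\<close>. Conservation expresses the flow on each remaining
  arc, one from a vertex to the next, as \<open>1\<close> minus a sum of such coordinates, and integral flows
  correspond to integral coordinates. Hence the polytope is the set of nonnegative \<open>(y, x)\<close> with
  \<open>y\<^sub>1 + \<dots> + y\<^sub>k + (sum of all x\<^sub>r with r > N (k - 1)) \<le> 1\<close> for \<open>k = 1, \<dots>, a\<close>.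

  These inequalities define Stanley's chain polytope of the poset consisting of the two chains
  \<open>y\<^sub>1 < \<dots> < y\<^sub>a\<close> and \<open>x\<^sub>1 < \<dots> < x\<^sub>b\<close>, in which \<open>y\<^sub>k < x\<^sub>r\<close> holds exactly if the \<open>k\<close>-th north step of
  \<open>\<nu>\<close> precedes its \<open>r\<close>-th east step. The linear extensions of this poset are the shuffles of
  \<open>a\<close> north and \<open>b\<close> east steps in which every east step occurs no lower than in \<open>\<nu>\<close>, that is,
  the \<open>\<nu>\<close>-Dyck paths; so the theorem is an instance of the equality of normalized volume and
  number of linear extensions.

  That equality is proved here for two chains by matching recursions. Let the height of an
  element be the largest sum of coordinates over a chain that ends in it, and let \<open>V k r s\<close> be
  the volume of the part where \<open>y\<^sub>1, \<dots>, y\<^sub>k, x\<^sub>1, \<dots>, x\<^sub>r\<close> have heights at most \<open>s\<close>. The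
  largest height is attained at \<open>y\<^sub>k\<close> or \<open>x\<^sub>r\<close>, and almost surely only at one of them. The
  coordinate of this element then ranges over an interval of length \<open>s - H\<close>, where \<open>H\<close> is the
  largest height of the rest, and integrating \<open>s - H\<close> over the other coordinates yields
  the integral of \<open>V (k - 1) r v\<close> or \<open>V k (r - 1) v\<close>, respectively, over \<open>0 \<le> v \<le> s\<close>. If
  \<open>y\<^sub>k < x\<^sub>r\<close>, the first case does not occur. Removing the last step of a
  lattice path yields the same recursion for the number of paths, whence \<open>volume_two_chains\<close>:
  \<open>V k r s\<close> is the number of paths from the origin to \<open>(r, k)\<close> weakly above \<open>\<nu>\<close> times \<open>s ^ (k + r) / (k + r)!\<close>.

  The normalized volume is measured in an unspecified lattice frame, so it must be shown
  that the coordinates above compute it. The change of coordinates is an affine bijection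
  \<open>L\<close> that permutes the integer points. A Fubini argument in the style of the
  uniqueness of Haar measure shows that \<open>L\<close> scales every volume by the same factor, and this
  factor is \<open>1\<close> because the preimage of the unit cube is again a fundamental domain
  of the integer lattice (\<open>emeasure_lattice_preserving_affine_vimage\<close>).
\<close>


section \<open>Lebesgue measure under lattice-preserving affine maps\<close>

lemma nn_integral_PiM_lborel_translate:
  fixes f :: "('i \<Rightarrow> real) \<Rightarrow> ennreal" and c :: "'i \<Rightarrow> real"
  assumes "finite I" and [measurable]: "f \<in> borel_measurable (\<Pi>\<^sub>M i\<in>I. lborel)"
  shows "(\<integral>\<^sup>+t. f (\<lambda>i\<in>I. t i + c i) \<partial>(\<Pi>\<^sub>M i\<in>I. lborel)) = (\<integral>\<^sup>+t. f t \<partial>(\<Pi>\<^sub>M i\<in>I. lborel))"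
proof -
  let ?M = "\<Pi>\<^sub>M i\<in>I. (lborel :: real measure)"
  let ?T = "\<lambda>t. \<lambda>i\<in>I. t i + c i"
  interpret product_sigma_finite "\<lambda>_::'i. lborel :: real measure"
    by standard
  have T[measurable]: "?T \<in> ?M \<rightarrow>\<^sub>M ?M"
    by measurable
  have "distr ?M ?M ?T = ?M"
  proof (rule PiM_eqI[OF \<open>finite I\<close>])
    show "sets (distr ?M ?M ?T) = sets ?M" by simp
    fix A :: "'i \<Rightarrow> real set" assume A: "\<And>i. i \<in> I \<Longrightarrow> A i \<in> sets lborel"
    have AI: "Pi\<^sub>E I A \<in> sets ?M"
      using A \<open>finite I\<close> by (intro sets_PiM_I_finite)
    have "?T -` Pi\<^sub>E I A \<inter> space ?M = Pi\<^sub>E I (\<lambda>i. (\<lambda>x. x + c i) -` A i)"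
      by (auto simp: space_PiM PiE_iff)
    then have "emeasure (distr ?M ?M ?T) (Pi\<^sub>E I A) = emeasure ?M (Pi\<^sub>E I (\<lambda>i. (\<lambda>x. x + c i) -` A i))"
      using AI by (simp add: emeasure_distr)
    also have "\<dots> = (\<Prod>i\<in>I. emeasure lborel ((\<lambda>x. x + c i) -` A i))"
      using A by (intro emeasure_PiM \<open>finite I\<close>) (auto intro!: measurable_sets_borel[of _ borel])
    also have "\<dots> = (\<Prod>i\<in>I. emeasure lborel (A i))"
    proof (rule prod.cong[OF refl])
      fix i assume "i \<in> I"
      then have "emeasure lborel (A i) = emeasure (distr lborel borel ((+) (c i))) (A i)"
        by (subst lborel_distr_plus) simp
      also have "\<dots> = emeasure lborel ((+) (c i) -` A i)"
        using A[OF \<open>i \<in> I\<close>] by (subst emeasure_distr) auto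
      also have "(+) (c i) = (\<lambda>x. x + c i)"
        by (simp add: fun_eq_iff add.commute)
      finally show "emeasure lborel ((\<lambda>x. x + c i) -` A i) = emeasure lborel (A i)" ..
    qed
    finally show "emeasure (distr ?M ?M ?T) (Pi\<^sub>E I A) = (\<Prod>i\<in>I. emeasure lborel (A i))" .
  qed
  then have "(\<integral>\<^sup>+t. f t \<partial>?M) = (\<integral>\<^sup>+t. f t \<partial>distr ?M ?M ?T)" by simp
  also have "\<dots> = (\<integral>\<^sup>+t. f (?T t) \<partial>?M)"
    by (rule nn_integral_distr[OF T]) simp
  finally show ?thesis ..
qed

text \<open>
  Two fundamental domains of the same lattice have the same measure: cutting \<open>F\<close> along the lattice
  translates of the unit cube \<open>Q\<close> and moving the pieces into \<open>Q\<close> tiles \<open>Q\<close> exactly once.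
\<close>
lemma emeasure_lattice_fundamental_domain:
  fixes F :: "('i \<Rightarrow> real) set"
  assumes "finite I" and F: "F \<in> sets (\<Pi>\<^sub>M i\<in>I. lborel)"
    and dom: "\<And>t. t \<in> I \<rightarrow>\<^sub>E UNIV \<Longrightarrow> \<exists>!z. z \<in> I \<rightarrow>\<^sub>E \<int> \<and> (\<lambda>i\<in>I. t i - z i) \<in> F"
  shows "emeasure (\<Pi>\<^sub>M i\<in>I. lborel) F = 1"
proof -
  let ?M = "\<Pi>\<^sub>M i\<in>I. (lborel :: real measure)"
  let ?Z = "I \<rightarrow>\<^sub>E (\<int> :: real set)"
  define Q :: "('i \<Rightarrow> real) set" where "Q = I \<rightarrow>\<^sub>E {0..<1}"
  interpret product_sigma_finite "\<lambda>_::'i. lborel :: real measure"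
    by standard
  have Q[measurable]: "Q \<in> sets ?M"
    unfolding Q_def using \<open>finite I\<close> by (intro sets_PiM_I_finite) auto
  note F[measurable]
  have Z: "countable ?Z"
    using \<open>finite I\<close> by (intro countable_PiE countable_int)
  \<comment> \<open>This writes 1 as a sum over the lattice. It is used once to introduce the translates of \<open>Q\<close> and
    once, after the translation of every term, to remove those of \<open>F\<close>.\<close>
  have unique: "(\<integral>\<^sup>+z. indicator A (g z) \<partial>count_space ?Z) = (1 :: ennreal)"
    if "\<exists>!z. z \<in> ?Z \<and> g z \<in> A" for A :: "('i \<Rightarrow> real) set" and g
  proof -
    from that obtain z0 where z0: "z0 \<in> ?Z" "g z0 \<in> A" "\<forall>z. z \<in> ?Z \<and> g z \<in> A \<longrightarrow> z = z0"
      by (elim ex1E) (erule conjE, assumption)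
    have "indicator A (g z) = (indicator {z0} z :: ennreal)" if "z \<in> ?Z" for z
    proof (cases "z = z0")
      case False
      with z0(3) that have "g z \<notin> A" by blast
      with False show ?thesis by simp
    qed (simp add: z0(2))
    then have "(\<integral>\<^sup>+z. indicator A (g z) \<partial>count_space ?Z)
        = (\<integral>\<^sup>+z. (indicator {z0} z :: ennreal) \<partial>count_space ?Z)"
      by (intro nn_integral_cong) simp
    then show ?thesis using z0(1) by simp
  qed
  have domQ: "\<exists>!z. z \<in> ?Z \<and> (\<lambda>i\<in>I. t i + z i) \<in> Q" for t :: "'i \<Rightarrow> real"
  proof (rule ex1I)
    show "(\<lambda>i\<in>I. - of_int \<lfloor>t i\<rfloor>) \<in> ?Z \<and> (\<lambda>i\<in>I. t i + (\<lambda>i\<in>I. - of_int \<lfloor>t i\<rfloor>) i) \<in> Q"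
      by (auto simp: Q_def PiE_iff) linarith
    fix z assume z: "z \<in> ?Z \<and> (\<lambda>i\<in>I. t i + z i) \<in> Q"
    show "z = (\<lambda>i\<in>I. - of_int \<lfloor>t i\<rfloor>)"
    proof (rule extensionalityI[of _ I])
      fix i assume i: "i \<in> I"
      with z obtain m where m: "z i = of_int m" by (auto elim!: PiE_E Ints_cases)
      have "0 \<le> t i + z i" "t i + z i < 1" using z i by (auto simp: Q_def PiE_iff)
      then have "\<lfloor>t i\<rfloor> = - m" unfolding m by linarith
      then show "z i = (\<lambda>i\<in>I. - of_int \<lfloor>t i\<rfloor>) i" using i m by simp
    qed (use z in \<open>auto simp: PiE_iff\<close>)
  qed
  have "emeasure ?M F = (\<integral>\<^sup>+t. indicator F t * (\<integral>\<^sup>+z. indicator Q (\<lambda>i\<in>I. t i + z i) \<partial>count_space ?Z) \<partial>?M)"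
    using unique[OF domQ] by simp
  also have "\<dots> = (\<integral>\<^sup>+t. (\<integral>\<^sup>+z. indicator F t * indicator Q (\<lambda>i\<in>I. t i + z i) \<partial>count_space ?Z) \<partial>?M)"
    by (simp add: nn_integral_cmult)
  also have "\<dots> = (\<integral>\<^sup>+z. (\<integral>\<^sup>+t. indicator F t * indicator Q (\<lambda>i\<in>I. t i + z i) \<partial>?M) \<partial>count_space ?Z)"
    by (intro nn_integral_count_space_nn_integral Z) measurable
  also have "\<dots> = (\<integral>\<^sup>+z. (\<integral>\<^sup>+t. indicator F (\<lambda>i\<in>I. t i - z i) * indicator Q t \<partial>?M) \<partial>count_space ?Z)"
  proof (rule nn_integral_cong)
    fix z
    let ?f = "\<lambda>t. indicator F (\<lambda>i\<in>I. t i - z i) * indicator Q t :: ennreal"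
    have "(\<integral>\<^sup>+t. indicator F t * indicator Q (\<lambda>i\<in>I. t i + z i) \<partial>?M) = (\<integral>\<^sup>+t. ?f (\<lambda>i\<in>I. t i + z i) \<partial>?M)"
    proof (rule nn_integral_cong)
      fix t assume "t \<in> space ?M"
      then have "(\<lambda>i\<in>I. (\<lambda>i\<in>I. t i + z i) i - z i) = t"
        by (auto simp: space_PiM PiE_iff extensional_def)
      then show "indicator F t * indicator Q (\<lambda>i\<in>I. t i + z i) = ?f (\<lambda>i\<in>I. t i + z i)"
        by (simp only:)
    qed
    also have "\<dots> = (\<integral>\<^sup>+t. ?f t \<partial>?M)"
      by (intro nn_integral_PiM_lborel_translate \<open>finite I\<close>) measurable
    finally show "(\<integral>\<^sup>+t. indicator F t * indicator Q (\<lambda>i\<in>I. t i + z i) \<partial>?M) = (\<integral>\<^sup>+t. ?f t \<partial>?M)" .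
  qed
  also have "\<dots> = (\<integral>\<^sup>+t. (\<integral>\<^sup>+z. indicator F (\<lambda>i\<in>I. t i - z i) * indicator Q t \<partial>count_space ?Z) \<partial>?M)"
    by (intro nn_integral_count_space_nn_integral[symmetric] Z) measurable
  also have "\<dots> = (\<integral>\<^sup>+t. (\<integral>\<^sup>+z. indicator F (\<lambda>i\<in>I. t i - z i) \<partial>count_space ?Z) * indicator Q t \<partial>?M)"
    by (simp add: nn_integral_multc)
  also have "\<dots> = (\<integral>\<^sup>+t. indicator Q t \<partial>?M)"
    using unique[OF dom] by (intro nn_integral_cong) (simp add: space_PiM)
  also have "\<dots> = emeasure ?M Q"
    by (rule nn_integral_indicator[OF Q])
  also have "\<dots> = (\<Prod>i\<in>I. emeasure lborel {0..<1::real})"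
    using \<open>finite I\<close> unfolding Q_def by (intro emeasure_PiM) auto
  finally show ?thesis by simp
qed

text \<open>
  This is the classical proof that an invariant measure is unique up to scaling, applied to the
  image of Lebesgue measure under \<open>L\<close>. Equivariance makes the image measure translation
  invariant. It is phrased with preimages under \<open>L\<close>, so that every integral is one over Lebesgue
  measure and Fubini applies. The reflection appears since the argument
  turns \<open>A\<close> into \<open>u - A\<close>; it is removed by comparing \<open>L\<close> with the identity.
\<close>
lemma emeasure_vimage_eq_reflection:
  fixes L :: "('i \<Rightarrow> real) \<Rightarrow> 'i \<Rightarrow> real"
  assumes "finite I" and L[measurable]: "L \<in> (\<Pi>\<^sub>M i\<in>I. lborel) \<rightarrow>\<^sub>M (\<Pi>\<^sub>M i\<in>I. lborel)"
    and equivariant: "\<And>y. y \<in> I \<rightarrow>\<^sub>E UNIV \<Longrightarrow>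
      \<exists>y'. \<forall>t \<in> I \<rightarrow>\<^sub>E UNIV. L (\<lambda>i\<in>I. t i + y' i) = (\<lambda>i\<in>I. L t i + y i)"
    and cube: "emeasure (\<Pi>\<^sub>M i\<in>I. lborel) {t \<in> I \<rightarrow>\<^sub>E UNIV. L t \<in> I \<rightarrow>\<^sub>E {0..<1}} = 1"
    and A[measurable]: "A \<in> sets (\<Pi>\<^sub>M i\<in>I. lborel)"
  shows "emeasure (\<Pi>\<^sub>M i\<in>I. lborel) {t \<in> I \<rightarrow>\<^sub>E UNIV. L t \<in> A}
    = emeasure (\<Pi>\<^sub>M i\<in>I. lborel) {t \<in> I \<rightarrow>\<^sub>E UNIV. (\<lambda>i\<in>I. - t i) \<in> A}"
proof -
  let ?M = "\<Pi>\<^sub>M i\<in>I. (lborel :: real measure)"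
  let ?E = "I \<rightarrow>\<^sub>E (UNIV :: real set)"
  interpret product_sigma_finite "\<lambda>_::'i. lborel :: real measure"
    by standard
  interpret sigma_finite_measure ?M
    by (rule sigma_finite[OF \<open>finite I\<close>])
  interpret P: pair_sigma_finite ?M ?M ..
  define Q :: "('i \<Rightarrow> real) set" where "Q = I \<rightarrow>\<^sub>E {0..<1}"
  have Q[measurable]: "Q \<in> sets ?M"
    unfolding Q_def using \<open>finite I\<close> by (intro sets_PiM_I_finite) auto
  have space: "space ?M = ?E" by (simp add: space_PiM)
  have LE: "L t \<in> ?E" if "t \<in> ?E" for t
    using measurable_space[OF L] that by (simp add: space)
  have int_Q: "(\<integral>\<^sup>+t. indicator Q t \<partial>?M) = 1"
  proof -
    have "emeasure ?M Q = (\<Prod>i\<in>I. emeasure lborel {0..<1::real})"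
      unfolding Q_def using \<open>finite I\<close> by (intro emeasure_PiM) auto
    then show ?thesis by simp
  qed
  have int_vimage: "(\<integral>\<^sup>+t. indicator B (g t) \<partial>?M) = emeasure ?M {t \<in> ?E. g t \<in> B}"
    if [measurable]: "B \<in> sets ?M" "g \<in> ?M \<rightarrow>\<^sub>M ?M" for B g
  proof -
    have "{t \<in> ?E. g t \<in> B} = g -` B \<inter> space ?M" by (auto simp: space)
    also have "\<dots> \<in> sets ?M" by measurable
    finally have "{t \<in> ?E. g t \<in> B} \<in> sets ?M" .
    from nn_integral_indicator[OF this, symmetric] show ?thesis
      by (auto intro!: nn_integral_cong simp: indicator_def space)
  qed
  let ?f = "indicator A :: _ \<Rightarrow> ennreal" and ?g = "indicator Q :: _ \<Rightarrow> ennreal"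
  have plus: "(\<lambda>y. ?g (\<lambda>i\<in>I. y i + c i)) \<in> borel_measurable ?M" for c
    by measurable
  have jointly: "(\<lambda>(x, y). h (L x) y) \<in> borel_measurable (?M \<Otimes>\<^sub>M ?M)"
    if h: "(\<lambda>(u, y). h u y) \<in> borel_measurable (?M \<Otimes>\<^sub>M ?M)" for h :: "_ \<Rightarrow> _ \<Rightarrow> ennreal"
  proof -
    have "(\<lambda>(x, y). (L x, y)) \<in> ?M \<Otimes>\<^sub>M ?M \<rightarrow>\<^sub>M ?M \<Otimes>\<^sub>M ?M"
      by measurable
    from measurable_compose[OF this h] show ?thesis by (simp add: case_prod_unfold)
  qed
  have minus: "(\<lambda>y. ?f (\<lambda>i\<in>I. c i - y i)) \<in> borel_measurable ?M" for c
    by measurable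
  have "(\<integral>\<^sup>+x. ?f (L x) \<partial>?M) = (\<integral>\<^sup>+x. ?f (L x) * (\<integral>\<^sup>+y. ?g y \<partial>?M) \<partial>?M)"
    by (simp add: int_Q)
  \<comment> \<open>First translate \<open>y\<close> by \<open>L x\<close>; then, for fixed \<open>y\<close>, translate \<open>x\<close> so that \<open>L x\<close> moves by \<open>- y\<close>.
    This exchanges the roles of \<open>f\<close> and \<open>g\<close>.\<close>
  also have "\<dots> = (\<integral>\<^sup>+x. ?f (L x) * (\<integral>\<^sup>+y. ?g (\<lambda>i\<in>I. y i + L x i) \<partial>?M) \<partial>?M)"
    by (subst nn_integral_PiM_lborel_translate[OF \<open>finite I\<close>]) auto
  also have "\<dots> = (\<integral>\<^sup>+x. (\<integral>\<^sup>+y. ?f (L x) * ?g (\<lambda>i\<in>I. y i + L x i) \<partial>?M) \<partial>?M)"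
    by (intro nn_integral_cong nn_integral_cmult[symmetric] plus)
  also have "\<dots> = (\<integral>\<^sup>+y. (\<integral>\<^sup>+x. ?f (L x) * ?g (\<lambda>i\<in>I. y i + L x i) \<partial>?M) \<partial>?M)"
    by (rule P.Fubini'[symmetric, OF jointly[of "\<lambda>u y. ?f u * ?g (\<lambda>i\<in>I. y i + u i)"]]) measurable
  also have "\<dots> = (\<integral>\<^sup>+y. (\<integral>\<^sup>+x. ?f (\<lambda>i\<in>I. L x i - y i) * ?g (L x) \<partial>?M) \<partial>?M)"
  proof (rule nn_integral_cong)
    fix y assume y: "y \<in> space ?M"
    then obtain y' where y': "\<And>t. t \<in> ?E \<Longrightarrow> L (\<lambda>i\<in>I. t i + y' i) = (\<lambda>i\<in>I. L t i + y i)"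
      using equivariant[of y] by (auto simp: space)
    let ?h = "\<lambda>x. ?f (\<lambda>i\<in>I. L x i - y i) * ?g (L x)"
    have "(\<integral>\<^sup>+x. ?f (L x) * ?g (\<lambda>i\<in>I. y i + L x i) \<partial>?M) = (\<integral>\<^sup>+x. ?h (\<lambda>i\<in>I. x i + y' i) \<partial>?M)"
    proof (rule nn_integral_cong)
      fix x assume x: "x \<in> space ?M"
      have "(\<lambda>i\<in>I. (\<lambda>i\<in>I. L x i + y i) i - y i) = L x"
        using LE[of x] x by (auto simp: space PiE_iff extensional_def)
      moreover have "(\<lambda>i\<in>I. L x i + y i) = (\<lambda>i\<in>I. y i + L x i)"
        by (simp add: add.commute)
      ultimately show "?f (L x) * ?g (\<lambda>i\<in>I. y i + L x i) = ?h (\<lambda>i\<in>I. x i + y' i)"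
        using x by (simp only: y' space)
    qed
    also have "\<dots> = (\<integral>\<^sup>+x. ?h x \<partial>?M)"
    proof (intro nn_integral_PiM_lborel_translate \<open>finite I\<close> measurable_compose[OF L])
      have [measurable]: "(\<lambda>u. \<lambda>i\<in>I. u i - c i) \<in> ?M \<rightarrow>\<^sub>M ?M" for c :: "'i \<Rightarrow> real"
        by measurable
      show "(\<lambda>u. ?f (\<lambda>i\<in>I. u i - y i) * ?g u) \<in> borel_measurable ?M"
        by (intro borel_measurable_times_ennreal) measurable
    qed
    finally show "(\<integral>\<^sup>+x. ?f (L x) * ?g (\<lambda>i\<in>I. y i + L x i) \<partial>?M) = (\<integral>\<^sup>+x. ?h x \<partial>?M)" .
  qed
  also have "\<dots> = (\<integral>\<^sup>+x. (\<integral>\<^sup>+y. ?f (\<lambda>i\<in>I. L x i - y i) * ?g (L x) \<partial>?M) \<partial>?M)"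
    by (rule P.Fubini'[OF jointly[of "\<lambda>u y. ?f (\<lambda>i\<in>I. u i - y i) * ?g u"]]) measurable
  also have "\<dots> = (\<integral>\<^sup>+x. (\<integral>\<^sup>+y. ?f (\<lambda>i\<in>I. L x i - y i) \<partial>?M) * ?g (L x) \<partial>?M)"
    by (intro nn_integral_cong nn_integral_multc minus)
  also have "\<dots> = (\<integral>\<^sup>+x. (\<integral>\<^sup>+y. ?f (\<lambda>i\<in>I. - y i) \<partial>?M) * ?g (L x) \<partial>?M)"
  proof (rule nn_integral_cong)
    fix x
    have "(\<integral>\<^sup>+y. ?f (\<lambda>i\<in>I. L x i - y i) \<partial>?M) = (\<integral>\<^sup>+y. ?f (\<lambda>i\<in>I. - (\<lambda>i\<in>I. y i + - L x i) i) \<partial>?M)"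
      by (intro nn_integral_cong arg_cong[of _ _ ?f]) auto
    also have "\<dots> = (\<integral>\<^sup>+y. ?f (\<lambda>i\<in>I. - y i) \<partial>?M)"
      by (rule nn_integral_PiM_lborel_translate[OF \<open>finite I\<close>]) measurable
    finally show "(\<integral>\<^sup>+y. ?f (\<lambda>i\<in>I. L x i - y i) \<partial>?M) * ?g (L x)
        = (\<integral>\<^sup>+y. ?f (\<lambda>i\<in>I. - y i) \<partial>?M) * ?g (L x)" by (simp only:)
  qed
  also have "\<dots> = (\<integral>\<^sup>+y. ?f (\<lambda>i\<in>I. - y i) \<partial>?M) * (\<integral>\<^sup>+x. ?g (L x) \<partial>?M)"
    by (intro nn_integral_cmult) measurable
  also have "(\<integral>\<^sup>+x. ?g (L x) \<partial>?M) = 1"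
    using cube by (simp add: int_vimage) (simp add: Q_def)
  finally have "(\<integral>\<^sup>+x. ?f (L x) \<partial>?M) = (\<integral>\<^sup>+y. ?f (\<lambda>i\<in>I. - y i) \<partial>?M)"
    by (simp only: mult_1_right)
  moreover have "(\<lambda>y. \<lambda>i\<in>I. - y i) \<in> ?M \<rightarrow>\<^sub>M ?M"
    by measurable
  ultimately show ?thesis
    by (simp only: int_vimage[OF A L] int_vimage[OF A, of "\<lambda>y. \<lambda>i\<in>I. - y i"])
qed

text \<open>
  The constant in the uniqueness argument is the measure of the preimage of the half-open unit
  cube. As \<open>L\<close> permutes the lattice points, this preimage is a fundamental domain.
\<close>
lemma emeasure_lattice_preserving_affine_vimage:
  fixes I :: "'i set" and p :: "'i \<Rightarrow> real" and V :: "'i \<Rightarrow> 'i \<Rightarrow> real"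
  defines "L \<equiv> \<lambda>t. \<lambda>j\<in>I. p j + (\<Sum>i\<in>I. t i * V i j)"
  assumes "finite I" and bij: "bij_betw L (I \<rightarrow>\<^sub>E UNIV) (I \<rightarrow>\<^sub>E UNIV)"
    and lattice: "L ` (I \<rightarrow>\<^sub>E \<int>) = I \<rightarrow>\<^sub>E \<int>"
    and A: "A \<in> sets (\<Pi>\<^sub>M i\<in>I. lborel)"
  shows "emeasure (\<Pi>\<^sub>M i\<in>I. lborel) {t \<in> I \<rightarrow>\<^sub>E UNIV. L t \<in> A} = emeasure (\<Pi>\<^sub>M i\<in>I. lborel) A"
proof -
  let ?M = "\<Pi>\<^sub>M i\<in>I. (lborel :: real measure)"
  let ?E = "I \<rightarrow>\<^sub>E (UNIV :: real set)"
  let ?Z = "I \<rightarrow>\<^sub>E (\<int> :: real set)"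
  interpret product_sigma_finite "\<lambda>_::'i. lborel :: real measure"
    by standard
  define Q :: "('i \<Rightarrow> real) set" where "Q = I \<rightarrow>\<^sub>E {0..<1}"
  have Q[measurable]: "Q \<in> sets ?M"
    unfolding Q_def using \<open>finite I\<close> by (intro sets_PiM_I_finite) auto
  have space: "space ?M = ?E" by (simp add: space_PiM)
  have L[measurable]: "L \<in> ?M \<rightarrow>\<^sub>M ?M"
    unfolding L_def by measurable
  have linear: "L (\<lambda>i\<in>I. t i + y' i) = (\<lambda>i\<in>I. L t i + y i)"
    if "L y' = (\<lambda>i\<in>I. p i + y i)" for t y y'
  proof -
    have "(\<Sum>i\<in>I. y' i * V i j) = y j" if "j \<in> I" for j
      using fun_cong[OF \<open>L y' = _\<close>, of j] that by (simp add: L_def)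
    then show ?thesis
      by (auto simp: L_def fun_eq_iff sum.distrib algebra_simps)
  qed
  have p: "(\<lambda>i\<in>I. p i) \<in> ?Z"
  proof -
    have "L (\<lambda>i\<in>I. 0) \<in> L ` ?Z" by (intro imageI) auto
    also have "L (\<lambda>i\<in>I. 0) = (\<lambda>i\<in>I. p i)" by (auto simp: L_def fun_eq_iff)
    finally show ?thesis by (simp only: lattice)
  qed
  have equivariant: "\<exists>y'. \<forall>t\<in>?E. L (\<lambda>i\<in>I. t i + y' i) = (\<lambda>i\<in>I. L t i + y i)" for y
  proof -
    have "(\<lambda>i\<in>I. p i + y i) \<in> L ` ?E"
      using bij by (auto simp: bij_betw_def)
    then obtain y' where "L y' = (\<lambda>i\<in>I. p i + y i)" by auto
    with linear show ?thesis by blast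
  qed
  have "emeasure ?M {t \<in> ?E. L t \<in> Q} = 1"
  proof (rule emeasure_lattice_fundamental_domain[OF \<open>finite I\<close>])
    have "{t \<in> ?E. L t \<in> Q} = L -` Q \<inter> space ?M" by (auto simp: space)
    also have "\<dots> \<in> sets ?M" by measurable
    finally show "{t \<in> ?E. L t \<in> Q} \<in> sets ?M" .
    fix t assume t: "t \<in> ?E"
    define m where "m = (\<lambda>i\<in>I. of_int \<lfloor>L t i\<rfloor> :: real)"
    have translate: "L (\<lambda>i\<in>I. t i - z i) = (\<lambda>i\<in>I. L t i - (L z i - p i))" for z
      by (auto simp: L_def fun_eq_iff sum_subtractf algebra_simps)
    show "\<exists>!z. z \<in> ?Z \<and> (\<lambda>i\<in>I. t i - z i) \<in> {t \<in> ?E. L t \<in> Q}"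
    proof (rule ex_ex1I)
      have "(\<lambda>i\<in>I. p i + m i) \<in> ?Z"
        using p by (auto simp: m_def PiE_iff)
      then have "(\<lambda>i\<in>I. p i + m i) \<in> L ` ?Z" by (simp only: lattice)
      then obtain z where z: "z \<in> ?Z" "L z = (\<lambda>i\<in>I. p i + m i)"
        by (elim imageE) simp
      have "L (\<lambda>i\<in>I. t i - z i) \<in> Q"
        unfolding translate z(2) by (auto simp: Q_def m_def) linarith
      with z show "\<exists>z. z \<in> ?Z \<and> (\<lambda>i\<in>I. t i - z i) \<in> {t \<in> ?E. L t \<in> Q}" by auto
    next
      fix z z' assume *: "z \<in> ?Z \<and> (\<lambda>i\<in>I. t i - z i) \<in> {t \<in> ?E. L t \<in> Q}"
        "z' \<in> ?Z \<and> (\<lambda>i\<in>I. t i - z' i) \<in> {t \<in> ?E. L t \<in> Q}"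
      have coordinate: "L z i = p i + of_int \<lfloor>L t i\<rfloor>"
        if z: "z \<in> ?Z" "L (\<lambda>i\<in>I. t i - z i) \<in> Q" and i: "i \<in> I" for z i
      proof -
        have "L z \<in> ?Z" using z(1) lattice by blast
        then have "L z i - p i \<in> \<int>" using p i by (auto simp: PiE_iff)
        then obtain k where k: "L z i - p i = of_int k" by (auto elim: Ints_cases)
        have "0 \<le> L t i - (L z i - p i)" "L t i - (L z i - p i) < 1"
          using z(2) i unfolding translate by (auto simp: Q_def PiE_iff)
        then have "\<lfloor>L t i\<rfloor> = k" unfolding k by linarith
        with k show ?thesis by simp
      qed
      have "L z = L z'"
        using * by (intro extensionalityI[of _ I]) (auto simp: coordinate, auto simp: L_def)
      moreover have "z \<in> ?E" "z' \<in> ?E" using * by (auto simp: PiE_iff)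
      ultimately show "z = z'" using bij by (auto simp: bij_betw_def inj_on_def)
    qed
  qed
  then have "emeasure ?M {t \<in> ?E. L t \<in> A} = emeasure ?M {t \<in> ?E. (\<lambda>i\<in>I. - t i) \<in> A}"
    using equivariant by (intro emeasure_vimage_eq_reflection \<open>finite I\<close> A L) (auto simp: Q_def)
  also have "\<dots> = emeasure ?M {t \<in> ?E. t \<in> A}"
  proof (rule emeasure_vimage_eq_reflection[symmetric, OF \<open>finite I\<close> _ _ _ A])
    have "emeasure ?M Q = (\<Prod>i\<in>I. emeasure lborel {0..<1::real})"
      unfolding Q_def using \<open>finite I\<close> by (intro emeasure_PiM) auto
    moreover have "{t \<in> ?E. t \<in> Q} = Q" by (auto simp: Q_def PiE_def)
    ultimately show "emeasure ?M {t \<in> ?E. t \<in> I \<rightarrow>\<^sub>E {0..<1}} = 1" by (simp add: Q_def)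
  qed (auto intro: exI[of _ y for y])
  also have "{t \<in> ?E. t \<in> A} = A"
    using sets.sets_into_space[OF A] by (auto simp: space)
  finally show ?thesis .
qed


section \<open>Normalized volume in coordinates\<close>

lemma lookup_scaleR [simp]:
  "Poly_Mapping.lookup (c *\<^sub>R x) e = c *\<^sub>R Poly_Mapping.lookup x e"
proof -
  have "finite {i. c *\<^sub>R Poly_Mapping.lookup x i \<noteq> 0}"
    by (rule finite_subset[OF _ finite_lookup[of x]]) auto
  then show ?thesis by (simp add: scaleR_poly_mapping_def)
qed

lemma lookup_affine_chart:
  fixes p :: "'e \<Rightarrow>\<^sub>0 real"
  shows "Poly_Mapping.lookup (affine_chart d p v t) e
    = Poly_Mapping.lookup p e + (\<Sum>i<d. t i * Poly_Mapping.lookup (v i) e)"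
  by (simp add: affine_chart_def lookup_add lookup_sum)

text \<open>
  If the coordinates indexed by \<open>e\<close> identify the simplex with vertices \<open>q, q + w 0, \<dots>\<close> with the standard
  simplex and this simplex is contained in \<open>P\<close>, then \<open>(q, w)\<close> is a lattice frame. Any other
  frame, in particular the one chosen by the definition of the normalized volume,
  differs from it by a lattice-preserving affine map of the coordinate space: reading off
  the coordinates \<open>e\<close> of a point given in the other frame.
\<close>
lemma normalized_volume_eq_measure_in_coordinates:
  fixes P :: "('e \<Rightarrow>\<^sub>0 real) set" and e :: "nat \<Rightarrow> 'e" and d :: nat
  defines "M \<equiv> \<Pi>\<^sub>M i\<in>{..<d}. (lborel :: real measure)"
  assumes integral: "q \<in> integer_lattice" "\<And>i. i < d \<Longrightarrow> w i \<in> integer_lattice"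
    and coords: "\<And>j. j < d \<Longrightarrow> Poly_Mapping.lookup q (e j) = 0"
      "\<And>i j. i < d \<Longrightarrow> j < d \<Longrightarrow> Poly_Mapping.lookup (w i) (e j) = (if i = j then 1 else 0)"
    and simplex: "q \<in> P" "\<And>i. i < d \<Longrightarrow> q + w i \<in> P"
    and param: "P \<subseteq> affine_chart d q w ` ({..<d} \<rightarrow>\<^sub>E UNIV)"
    and meas: "{t \<in> {..<d} \<rightarrow>\<^sub>E UNIV. affine_chart d q w t \<in> P} \<in> sets M"
  shows "normalized_volume P
    = fact d * measure M {t \<in> {..<d} \<rightarrow>\<^sub>E UNIV. affine_chart d q w t \<in> P}"
proof -
  define S where "S = affine_chart d q w"
  let ?E = "{..<d} \<rightarrow>\<^sub>E (UNIV :: real set)"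
  let ?Z = "{..<d} \<rightarrow>\<^sub>E (\<int> :: real set)"
  have coord: "Poly_Mapping.lookup (S t) (e j) = t j" if "j < d" for t j
    using that unfolding S_def by (simp add: lookup_affine_chart coords if_distrib cong: if_cong)
  have inj: "inj_on S ?E"
  proof (rule inj_onI)
    fix t t' assume t: "t \<in> ?E" "t' \<in> ?E" and eq: "S t = S t'"
    have "t j = t' j" if "j < d" for j
      using coord[OF that] eq by metis
    with t show "t = t'" by (auto intro: PiE_ext)
  qed
  have hull: "affine hull P = S ` ?E"
  proof
    show "affine hull P \<subseteq> S ` ?E"
    proof (rule hull_minimal)
      show "P \<subseteq> S ` ?E" using param by (simp add: S_def)
      show "affine (S ` ?E)"
        unfolding affine_def
      proof safe
        fix t t' and u v :: real assume uv: "u + v = 1"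
        have "u *\<^sub>R S t + v *\<^sub>R S t' = (u + v) *\<^sub>R q + (\<Sum>i<d. (u * t i + v * t' i) *\<^sub>R w i)"
          by (simp add: S_def affine_chart_def scaleR_add_left scaleR_add_right scaleR_sum_right sum.distrib)
        also have "\<dots> = S (\<lambda>i\<in>{..<d}. u * t i + v * t' i)"
          by (simp add: S_def affine_chart_def uv)
        finally show "u *\<^sub>R S t + v *\<^sub>R S t' \<in> S ` ?E" by auto
      qed
    qed
    show "S ` ?E \<subseteq> affine hull P"
    proof safe
      fix t :: "nat \<Rightarrow> real"
      have "q + (\<Sum>i<k. t i *\<^sub>R w i) \<in> affine hull P" if "k \<le> d" for k
        using that
      proof (induction k)
        case 0
        then show ?case using simplex by (simp add: hull_inc)
      next
        case (Suc k)
        have "q \<in> affine hull P" "q + w k \<in> affine hull P"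
          using simplex(1) simplex(2)[of k] Suc.prems by (simp_all add: hull_inc)
        with Suc have "q + (\<Sum>i<k. t i *\<^sub>R w i) + t k *\<^sub>R ((q + w k) - q) \<in> affine hull P"
          by (intro mem_affine_3_minus[OF affine_affine_hull]) simp_all
        then show ?case by (simp add: algebra_simps)
      qed
      then show "S t \<in> affine hull P" by (simp add: S_def affine_chart_def)
    qed
  qed
  have integral_S: "S t \<in> integer_lattice \<longleftrightarrow> t \<in> ?Z" if "t \<in> ?E" for t
  proof
    assume "S t \<in> integer_lattice"
    then have "t j \<in> \<int>" if "j < d" for j
      using coord[OF that, of t] unfolding integer_lattice_def mem_Collect_eq by metis
    with that show "t \<in> ?Z" by (auto simp: PiE_iff)
  next
    assume "t \<in> ?Z"
    then show "S t \<in> integer_lattice"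
      using integral by (auto simp: S_def integer_lattice_def lookup_affine_chart intro!: Ints_add Ints_sum Ints_mult)
  qed
  have ZE: "?Z \<subseteq> ?E" by (auto simp: PiE_iff)
  have "lattice_frame P d q w"
    unfolding lattice_frame_def S_def[symmetric] hull
    using inj integral_S ZE by (auto simp: bij_betw_def)
  moreover define p v where "p = fst (SOME (p, v). lattice_frame P d p v)"
    and "v = snd (SOME (p, v). lattice_frame P d p v)"
  ultimately have frame: "lattice_frame P d p v"
    using someI[of "\<lambda>(p, v). lattice_frame P d p v" "(q, w)"] by (simp add: case_prod_unfold)

  have dim: "affine_dimension P = d"
  proof -
    let ?D = "{x - y | x y. x \<in> P \<and> y \<in> P}"
    have inj_w: "inj_on w {..<d}"
    proof (rule inj_onI)
      fix i j assume ij: "i \<in> {..<d}" "j \<in> {..<d}" and "w i = w j"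
      then show "i = j" using coords(2)[of i j] coords(2)[of j j] by (auto split: if_splits)
    qed
    have indep: "independent (w ` {..<d})"
    proof (rule independent_if_scalars_zero)
      fix f x assume zero: "(\<Sum>x\<in>w ` {..<d}. f x *\<^sub>R x) = 0" and "x \<in> w ` {..<d}"
      then obtain j where j: "j < d" "x = w j" by auto
      have "0 = Poly_Mapping.lookup (\<Sum>i<d. f (w i) *\<^sub>R w i) (e j)"
        using zero by (simp add: sum.reindex[OF inj_w])
      also have "\<dots> = f (w j)"
        using j by (simp add: lookup_sum coords if_distrib cong: if_cong)
      finally show "f x = 0" using j by simp
    qed simp
    have "w ` {..<d} \<subseteq> ?D"
    proof safe
      fix i assume "i < d"
      then show "\<exists>x y. w i = x - y \<and> x \<in> P \<and> y \<in> P"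
        using simplex by (intro exI[of _ "q + w i"] exI[of _ q]) auto
    qed
    moreover have "?D \<subseteq> span (w ` {..<d})"
    proof safe
      fix x y assume "x \<in> P" "y \<in> P"
      then obtain t t' where "x = S t" "y = S t'" using param unfolding S_def by blast
      then have "x - y = (\<Sum>i<d. (t i - t' i) *\<^sub>R w i)"
        by (simp add: S_def affine_chart_def sum_subtractf scaleR_diff_left)
      then show "x - y \<in> span (w ` {..<d})"
        by (simp only:) (intro span_sum span_scale span_base imageI)
    qed
    ultimately have "span (w ` {..<d}) = span ?D"
      by (metis (no_types, lifting) span_mono span_span subset_antisym)
    from dim_eq_card[OF this indep] show ?thesis
      by (simp add: affine_dimension_def card_image[OF inj_w])
  qed

  define L where "L = (\<lambda>t. \<lambda>j\<in>{..<d}. Poly_Mapping.lookup p (e j)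
    + (\<Sum>i\<in>{..<d}. t i * Poly_Mapping.lookup (v i) (e j)))"
  let ?R = "affine_chart d p v"
  have R: "bij_betw ?R ?E (S ` ?E)" "?R ` ?Z = S ` ?E \<inter> integer_lattice"
    using frame by (simp_all add: lattice_frame_def hull)
  have SL: "S (L t) = ?R t" if "t \<in> ?E" for t
  proof -
    have "?R t \<in> S ` ?E" by (rule bij_betw_apply[OF R(1) that])
    then obtain t' where t': "t' \<in> ?E" "?R t = S t'" by blast
    have "L t j = t' j" if "j < d" for j
      using coord[OF that, of t'] that by (simp add: L_def t'(2)[symmetric] lookup_affine_chart)
    with t' have "L t = t'" by (intro PiE_ext[of _ "{..<d}"]) (auto simp: L_def)
    with t' show ?thesis by simp
  qed
  have LE: "L t \<in> ?E" for t by (auto simp: L_def)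
  have "bij_betw (S \<circ> L) ?E (S ` ?E) \<longleftrightarrow> bij_betw ?R ?E (S ` ?E)"
    by (rule bij_betw_cong) (simp add: SL)
  then have SL_bij: "bij_betw (S \<circ> L) ?E (S ` ?E)"
    using R(1) by (rule iffD2)
  have "L ` ?E \<subseteq> ?E" using LE by (intro image_subsetI)
  then have bij: "bij_betw L ?E ?E"
    by (rule bij_betw_comp_iff2[OF inj_on_imp_bij_betw[OF inj], THEN iffD2, OF _ SL_bij])
  have lattice: "L ` ?Z = ?Z"
  proof -
    have "S ` (L ` ?Z) = ?R ` ?Z"
      unfolding image_image by (rule image_cong[OF refl SL]) (use ZE in blast)
    also have "\<dots> = S ` ?Z"
      unfolding R(2) using integral_S ZE by blast
    finally have "S ` (L ` ?Z) = S ` ?Z" .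
    moreover have "L ` ?Z \<subseteq> ?E" using LE by (intro image_subsetI)
    ultimately show ?thesis
      by (simp add: inj_on_image_eq_iff[OF inj _ ZE])
  qed
  have "emeasure M {t \<in> ?E. L t \<in> {t \<in> ?E. S t \<in> P}} = emeasure M {t \<in> ?E. S t \<in> P}"
    unfolding L_def M_def
    by (rule emeasure_lattice_preserving_affine_vimage[OF _ bij[unfolded L_def] lattice[unfolded L_def]])
      (simp, rule meas[unfolded M_def, folded S_def])
  moreover have "{t \<in> ?E. ?R t \<in> P} = {t \<in> ?E. L t \<in> {t \<in> ?E. S t \<in> P}}"
    using SL LE by auto
  moreover have "normalized_volume P = fact d * measure M {t \<in> ?E. ?R t \<in> P}"
    unfolding normalized_volume_def dim Let_def case_prod_unfold M_def p_def v_def ..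
  ultimately show ?thesis by (simp add: measure_def S_def)
qed


section \<open>The volume of a union of two chains\<close>

text \<open>
  The number of lattice paths from the origin to \<open>(r, k)\<close> all of whose points \<open>(x, y)\<close> satisfy
  \<open>x \<le> N y\<close>, computed by removing the last step.
\<close>
fun path_count :: "(nat \<Rightarrow> nat) \<Rightarrow> nat \<Rightarrow> nat \<Rightarrow> nat" where
  "path_count N 0 0 = 1"
| "path_count N 0 (Suc r) = (if Suc r \<le> N 0 then path_count N 0 r else 0)"
| "path_count N (Suc k) 0 = path_count N k 0"
| "path_count N (Suc k) (Suc r) =
    (if Suc r \<le> N (Suc k) then path_count N k (Suc r) + path_count N (Suc k) r else 0)"

text \<open>
  The coordinates of the first chain have the indices \<open>0, \<dots>, a - 1\<close> and those of the second chain
  the indices from \<open>a\<close> on. The \<open>j\<close>-th element of the second chain (counted from \<open>1\<close>) lies above exactly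
  the first \<open>lo j\<close> elements of the first chain. For nonnegative coordinates, the value at \<open>r > 0\<close> is the
  height of the \<open>r\<close>-th element of the second chain. At \<open>r = 0\<close> any negative number would do: it must
  be less than every sum over the first chain, including \<open>0\<close>, so that the empty second chain
  never attains the largest height.
\<close>
fun x_height :: "nat \<Rightarrow> (nat \<Rightarrow> nat) \<Rightarrow> (nat \<Rightarrow> real) \<Rightarrow> nat \<Rightarrow> real" where
  "x_height a lo t 0 = -1"
| "x_height a lo t (Suc r) = max (x_height a lo t r) (\<Sum>i<lo (Suc r). t i) + t (a + r)"

definition height :: "nat \<Rightarrow> (nat \<Rightarrow> nat) \<Rightarrow> nat \<Rightarrow> nat \<Rightarrow> (nat \<Rightarrow> real) \<Rightarrow> real" where
  "height a lo k r t = max (\<Sum>i<k. t i) (x_height a lo t r)"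

definition two_chains :: "nat \<Rightarrow> nat \<Rightarrow> nat \<Rightarrow> nat set" where
  "two_chains a k r = {..<k} \<union> {a..<a + r}"

definition orthant :: "'i set \<Rightarrow> ('i \<Rightarrow> real) set" where
  "orthant I = I \<rightarrow>\<^sub>E {0..}"

lemma finite_two_chains [simp]: "finite (two_chains a k r)"
  by (simp add: two_chains_def)

lemma measurable_PiM_component_lborel [measurable]:
  "(\<lambda>t. t i) \<in> borel_measurable (\<Pi>\<^sub>M i\<in>I. (lborel :: real measure))"
proof (cases "i \<in> I")
  case True
  then show ?thesis using measurable_component_singleton[of i I "\<lambda>_. lborel :: real measure"] by simp
next
  case False
  have "(\<lambda>t. undefined) \<in> borel_measurable (\<Pi>\<^sub>M i\<in>I. (lborel :: real measure))" by simp
  then show ?thesis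
    by (rule measurable_cong[THEN iffD1, rotated]) (use False in \<open>auto simp: space_PiM PiE_iff extensional_def\<close>)
qed

lemma measurable_x_height [measurable]:
  "(\<lambda>t. x_height a lo t r) \<in> borel_measurable (\<Pi>\<^sub>M i\<in>I. (lborel :: real measure))"
proof (induction r)
  case (Suc r)
  note Suc[measurable]
  show ?case unfolding x_height.simps by measurable
qed simp

lemma measurable_height [measurable]:
  "height a lo k r \<in> borel_measurable (\<Pi>\<^sub>M i\<in>I. (lborel :: real measure))"
proof -
  have "(\<lambda>t. max (\<Sum>i<k. t i) (x_height a lo t r)) \<in> borel_measurable (\<Pi>\<^sub>M i\<in>I. (lborel :: real measure))"
    by measurable
  then show ?thesis by (simp add: height_def[abs_def])
qed

lemma sets_orthant [measurable]:
  "finite I \<Longrightarrow> orthant I \<in> sets (\<Pi>\<^sub>M i\<in>I. (lborel :: real measure))"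
  unfolding orthant_def by (intro sets_PiM_I_finite) auto

text \<open>
  Layer-cake formula: \<open>s - H t\<close> is the length of the set of levels \<open>v \<le> s\<close> with \<open>H t \<le> v\<close>, so by
  Fubini the integral equals that of the sublevel volumes over \<open>0 \<le> v \<le> s\<close>. This is the step that
  raises the exponent and the factorial by one.
\<close>
lemma nn_integral_deficit_eq_power:
  fixes H :: "'a \<Rightarrow> real"
  assumes "sigma_finite_measure M" and S[measurable]: "S \<in> sets M"
    and H[measurable]: "H \<in> borel_measurable M"
    and nonneg: "\<And>t. t \<in> S \<Longrightarrow> 0 \<le> H t"
    and sublevel: "\<And>v. 0 \<le> v \<Longrightarrow> emeasure M {t \<in> S. H t \<le> v} = ennreal (c * v ^ n / fact n)"
    and "0 \<le> c" "0 \<le> s"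
  shows "(\<integral>\<^sup>+t. indicator S t * ennreal (s - H t) \<partial>M) = ennreal (c * s ^ Suc n / fact (Suc n))"
proof -
  interpret M: sigma_finite_measure M by fact
  interpret pair_sigma_finite lborel M ..
  have SM: "S \<subseteq> space M" by (rule sets.sets_into_space[OF S])
  let ?g = "\<lambda>v t. indicator {0..s} v * (indicator S t * indicator {..v} (H t)) :: ennreal"
  have g: "case_prod ?g \<in> borel_measurable (lborel \<Otimes>\<^sub>M M)"
  proof -
    have "case_prod ?g = (\<lambda>(v, t). if v \<in> {0..s} \<and> t \<in> S \<and> H t \<le> v then 1 else 0)"
      by (auto simp: fun_eq_iff indicator_def)
    also have "\<dots> \<in> borel_measurable (lborel \<Otimes>\<^sub>M M)"
      by measurable
    finally show ?thesis .
  qed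
  have "(\<integral>\<^sup>+t. indicator S t * ennreal (s - H t) \<partial>M) = (\<integral>\<^sup>+t. (\<integral>\<^sup>+v. ?g v t \<partial>lborel) \<partial>M)"
  proof (rule nn_integral_cong)
    fix t
    show "indicator S t * ennreal (s - H t) = (\<integral>\<^sup>+v. ?g v t \<partial>lborel)"
    proof (cases "t \<in> S")
      case True
      then have "(\<integral>\<^sup>+v. ?g v t \<partial>lborel) = (\<integral>\<^sup>+v. indicator {H t..s} v \<partial>lborel)"
        using nonneg[OF True] by (intro nn_integral_cong) (auto simp: indicator_def)
      also have "\<dots> = ennreal (s - H t)"
        by (simp add: emeasure_lborel_Icc_eq ennreal_neg)
      finally show ?thesis using True by simp
    qed simp
  qed
  also have "\<dots> = (\<integral>\<^sup>+v. (\<integral>\<^sup>+t. ?g v t \<partial>M) \<partial>lborel)"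
    by (rule Fubini'[OF g])
  also have "\<dots> = (\<integral>\<^sup>+v. ennreal (c * v ^ n / fact n) * indicator {0..s} v \<partial>lborel)"
  proof (rule nn_integral_cong)
    fix v :: real
    have "(\<integral>\<^sup>+t. ?g v t \<partial>M) = ennreal (c * v ^ n / fact n)" if v: "v \<in> {0..s}"
    proof -
      have "{t \<in> S. H t \<le> v} = S \<inter> {t \<in> space M. H t \<le> v}" using SM by auto
      also have "\<dots> \<in> sets M" by measurable
      finally have "{t \<in> S. H t \<le> v} \<in> sets M" .
      moreover have "(\<integral>\<^sup>+t. ?g v t \<partial>M) = (\<integral>\<^sup>+t. indicator {t \<in> S. H t \<le> v} t \<partial>M)"
        using v by (intro nn_integral_cong) (auto simp: indicator_def)
      ultimately show ?thesis using v sublevel[of v] by simp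
    qed
    then show "(\<integral>\<^sup>+t. ?g v t \<partial>M) = ennreal (c * v ^ n / fact n) * indicator {0..s} v"
      by (cases "v \<in> {0..s}") auto
  qed
  also have "\<dots> = ennreal (c * s ^ Suc n / fact (Suc n) - c * 0 ^ Suc n / fact (Suc n))"
  proof (rule nn_integral_FTC_Icc)
    fix v :: real assume "v \<in> {0..s}"
    then show "0 \<le> c * v ^ n / fact n" using \<open>0 \<le> c\<close> by simp
    have "((\<lambda>v. c / fact (Suc n) * v ^ Suc n) has_real_derivative
        c / fact (Suc n) * (real (Suc n) * v ^ (Suc n - Suc 0))) (at v)"
      by (intro DERIV_cmult DERIV_pow)
    moreover have "c / fact (Suc n) * (real (Suc n) * v ^ (Suc n - Suc 0)) = c * v ^ n / fact n"
      by (simp add: divide_simps)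
    ultimately show "((\<lambda>v. c * v ^ Suc n / fact (Suc n)) has_real_derivative c * v ^ n / fact n) (at v)"
      by simp
  qed (use \<open>0 \<le> s\<close> in auto)
  finally show ?thesis by simp
qed

lemma x_height_cong:
  assumes "\<And>i. i < a + r \<Longrightarrow> a \<le> i \<Longrightarrow> t i = t' i"
    and "\<And>i j. 1 \<le> j \<Longrightarrow> j \<le> r \<Longrightarrow> i < lo j \<Longrightarrow> t i = t' i"
  shows "x_height a lo t r = x_height a lo t' r"
  using assms
proof (induction r)
  case (Suc r)
  have "x_height a lo t r = x_height a lo t' r" by (rule Suc.IH) (use Suc.prems in auto)
  moreover have "(\<Sum>i<lo (Suc r). t i) = (\<Sum>i<lo (Suc r). t' i)"
    using Suc.prems(2)[of "Suc r"] by (intro sum.cong) auto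
  ultimately show ?case using Suc.prems(1)[of "a + r"] by simp
qed simp

lemma sets_last_step:
  fixes a k r s
  defines "M \<equiv> \<Pi>\<^sub>M i\<in>two_chains a k r. (lborel :: real measure)"
  shows "{t \<in> orthant (two_chains a k r). height a lo k r t \<le> s \<and> x_height a lo t r < (\<Sum>i<k. t i)} \<in> sets M"
      (is "?A \<in> _")
    and "{t \<in> orthant (two_chains a k r). height a lo k r t \<le> s \<and> (\<Sum>i<k. t i) \<le> x_height a lo t r} \<in> sets M"
      (is "?B \<in> _")
proof -
  have H: "height a lo k r \<in> borel_measurable M" and X: "(\<lambda>t. x_height a lo t r) \<in> borel_measurable M"
    unfolding M_def by measurable
  have Y: "(\<lambda>t. \<Sum>i<k. t i) \<in> borel_measurable M"
    unfolding M_def by (intro borel_measurable_sum measurable_PiM_component_lborel)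
  have O_sets: "orthant (two_chains a k r) \<in> sets M" by (simp add: M_def)
  let ?O = "orthant (two_chains a k r)"
  have O: "?O \<subseteq> space M" by (auto simp: M_def orthant_def space_PiM PiE_iff)
  have "?A = ?O \<inter> {t \<in> space M. height a lo k r t \<le> s \<and> x_height a lo t r < (\<Sum>i<k. t i)}"
    using O by auto
  also have "\<dots> \<in> sets M" by (intro sets.Int sets.sets_Collect_conj borel_measurable_le borel_measurable_less borel_measurable_const H X Y O_sets)
  finally show "?A \<in> sets M" .
  have "?B = ?O \<inter> {t \<in> space M. height a lo k r t \<le> s \<and> (\<Sum>i<k. t i) \<le> x_height a lo t r}"
    using O by auto
  also have "\<dots> \<in> sets M" by (intro sets.Int sets.sets_Collect_conj borel_measurable_le borel_measurable_const H X Y O_sets)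
  finally show "?B \<in> sets M" .
qed

text \<open>
  If the first chain has the larger height and all other coordinates are fixed, then the height
  \<open>Y + u\<close> of its new element ranges over an interval from the height of the rest up to \<open>s\<close>. The
  hypothesis on \<open>lo\<close> says that no element of the second chain lies above the new one, so that
  the heights in the second chain do not depend on \<open>u\<close>.
\<close>
lemma volume_last_step_North:
  assumes "k < a" and lo: "\<And>j. 1 \<le> j \<Longrightarrow> j \<le> r \<Longrightarrow> lo j \<le> k"
  shows "emeasure (\<Pi>\<^sub>M i\<in>two_chains a (Suc k) r. lborel)
      {t \<in> orthant (two_chains a (Suc k) r). height a lo (Suc k) r t \<le> s
        \<and> x_height a lo t r < (\<Sum>i<Suc k. t i)}
    = (\<integral>\<^sup>+t. indicator (orthant (two_chains a k r)) t * ennreal (s - height a lo k r t)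
        \<partial>(\<Pi>\<^sub>M i\<in>two_chains a k r. lborel))"
proof -
  let ?J = "two_chains a k r"
  let ?M = "\<Pi>\<^sub>M i\<in>?J. (lborel :: real measure)"
  let ?M' = "\<Pi>\<^sub>M i\<in>insert k ?J. (lborel :: real measure)"
  interpret product_sigma_finite "\<lambda>_::nat. lborel :: real measure"
    by standard
  have J: "two_chains a (Suc k) r = insert k ?J" "k \<notin> ?J"
    using \<open>k < a\<close> by (auto simp: two_chains_def)
  define A where "A = {t \<in> orthant (insert k ?J). height a lo (Suc k) r t \<le> s
        \<and> x_height a lo t r < (\<Sum>i<Suc k. t i)}"
  have A: "A \<in> sets ?M'"
    unfolding A_def using sets_last_step(1)[of a "Suc k" r lo s] by (simp only: J)
  have "emeasure ?M' A = (\<integral>\<^sup>+t. indicator A t \<partial>?M')"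
    using A by simp
  also have "\<dots> = (\<integral>\<^sup>+t. (\<integral>\<^sup>+u. indicator A (t(k := u)) \<partial>lborel) \<partial>?M)"
    by (rule product_nn_integral_insert) (use A J in auto)
  also have "\<dots> = (\<integral>\<^sup>+t. indicator (orthant ?J) t * ennreal (s - height a lo k r t) \<partial>?M)"
  proof (rule nn_integral_cong)
    fix t assume t: "t \<in> space ?M"
    define Y X where "Y = (\<Sum>i<k. t i)" and "X = x_height a lo t r"
    have X: "x_height a lo (t(k := u)) r = X" for u
      unfolding X_def using lo \<open>k < a\<close> by (intro x_height_cong) fastforce+
    have Y: "(\<Sum>i<Suc k. (t(k := u)) i) = Y + u" for u
      by (simp add: Y_def)
    have orth: "t(k := u) \<in> orthant (insert k ?J) \<longleftrightarrow> t \<in> orthant ?J \<and> 0 \<le> u" for u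
      using t J(2) by (auto simp: orthant_def space_PiM PiE_iff extensional_def)
    define B where "B = (if X < Y then {0..s - Y} else {X - Y<..s - Y})"
    have iff: "t(k := u) \<in> A \<longleftrightarrow> t \<in> orthant ?J \<and> u \<in> B" for u
      unfolding A_def B_def height_def mem_Collect_eq orth X Y by auto
    have "(\<integral>\<^sup>+u. indicator A (t(k := u)) \<partial>lborel)
        = (\<integral>\<^sup>+u. indicator (orthant ?J) t * indicator B u \<partial>lborel)"
      using iff by (intro nn_integral_cong) (auto simp: indicator_def)
    also have "\<dots> = indicator (orthant ?J) t * emeasure lborel B"
      by (subst nn_integral_cmult) (auto simp: B_def)
    also have "emeasure lborel B = ennreal (s - max Y X)"
    proof (cases "X \<le> s")
      case True
      then show ?thesis
        by (auto simp: B_def emeasure_lborel_Icc_eq ennreal_neg max_def)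
    next
      case False
      then have "\<not> X < Y \<Longrightarrow> B = {}" by (auto simp: B_def)
      with False show ?thesis
        by (auto simp: B_def emeasure_lborel_Icc_eq ennreal_neg max_def)
    qed
    finally show "(\<integral>\<^sup>+u. indicator A (t(k := u)) \<partial>lborel)
        = indicator (orthant ?J) t * ennreal (s - height a lo k r t)"
      unfolding height_def X_def Y_def .
  qed
  finally show ?thesis by (simp only: J A_def)
qed

text \<open>
  The same computation for a new element of the second chain. Ties between the two chains are counted
  here; this affects only whether an endpoint belongs to the interval for \<open>u\<close>.
\<close>
lemma volume_last_step_East:
  assumes "k \<le> a" and lo: "\<And>j. 1 \<le> j \<Longrightarrow> j \<le> Suc r \<Longrightarrow> lo j \<le> k"
  shows "emeasure (\<Pi>\<^sub>M i\<in>two_chains a k (Suc r). lborel)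
      {t \<in> orthant (two_chains a k (Suc r)). height a lo k (Suc r) t \<le> s
        \<and> (\<Sum>i<k. t i) \<le> x_height a lo t (Suc r)}
    = (\<integral>\<^sup>+t. indicator (orthant (two_chains a k r)) t * ennreal (s - height a lo k r t)
        \<partial>(\<Pi>\<^sub>M i\<in>two_chains a k r. lborel))"
proof -
  let ?J = "two_chains a k r"
  let ?M = "\<Pi>\<^sub>M i\<in>?J. (lborel :: real measure)"
  let ?M' = "\<Pi>\<^sub>M i\<in>insert (a + r) ?J. (lborel :: real measure)"
  interpret product_sigma_finite "\<lambda>_::nat. lborel :: real measure"
    by standard
  have J: "two_chains a k (Suc r) = insert (a + r) ?J" "a + r \<notin> ?J"
    using \<open>k \<le> a\<close> by (auto simp: two_chains_def)
  define A where "A = {t \<in> orthant (insert (a + r) ?J). height a lo k (Suc r) t \<le> s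
        \<and> (\<Sum>i<k. t i) \<le> x_height a lo t (Suc r)}"
  have A: "A \<in> sets ?M'"
    unfolding A_def using sets_last_step(2)[of a k "Suc r" lo s] by (simp only: J)
  have "emeasure ?M' A = (\<integral>\<^sup>+t. indicator A t \<partial>?M')"
    using A by simp
  also have "\<dots> = (\<integral>\<^sup>+t. (\<integral>\<^sup>+u. indicator A (t(a + r := u)) \<partial>lborel) \<partial>?M)"
    by (rule product_nn_integral_insert) (use A J in auto)
  also have "\<dots> = (\<integral>\<^sup>+t. indicator (orthant ?J) t * ennreal (s - height a lo k r t) \<partial>?M)"
  proof (rule nn_integral_cong)
    fix t assume t: "t \<in> space ?M"
    define Y X G where "Y = (\<Sum>i<k. t i)" and "X = x_height a lo t r"
      and "G = max X (\<Sum>i<lo (Suc r). t i)"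
    have X: "x_height a lo (t(a + r := u)) (Suc r) = G + u" for u
    proof -
      have "x_height a lo (t(a + r := u)) r = X"
        unfolding X_def using \<open>k \<le> a\<close> lo by (intro x_height_cong) fastforce+
      moreover have "(\<Sum>i<lo (Suc r). (t(a + r := u)) i) = (\<Sum>i<lo (Suc r). t i)"
        using lo[of "Suc r"] \<open>k \<le> a\<close> by (intro sum.cong) auto
      ultimately show ?thesis by (simp add: G_def)
    qed
    have Y: "(\<Sum>i<k. (t(a + r := u)) i) = Y" for u
      unfolding Y_def using \<open>k \<le> a\<close> by (intro sum.cong) auto
    have orth: "t(a + r := u) \<in> orthant (insert (a + r) ?J) \<longleftrightarrow> t \<in> orthant ?J \<and> 0 \<le> u" for u
      using t J(2) by (auto simp: orthant_def space_PiM PiE_iff extensional_def)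
    have le: "(\<Sum>i<lo (Suc r). t i) \<le> Y" if "t \<in> orthant ?J"
      unfolding Y_def using that lo[of "Suc r"]
      by (intro sum_mono2) (auto simp: orthant_def two_chains_def PiE_iff)
    define B where "B = {max Y X - G..s - G}"
    have iff: "t(a + r := u) \<in> A \<longleftrightarrow> t \<in> orthant ?J \<and> u \<in> B" for u
      unfolding A_def B_def height_def mem_Collect_eq orth X Y using le by (auto simp: G_def)
    have "(\<integral>\<^sup>+u. indicator A (t(a + r := u)) \<partial>lborel)
        = (\<integral>\<^sup>+u. indicator (orthant ?J) t * indicator B u \<partial>lborel)"
      using iff by (intro nn_integral_cong) (auto simp: indicator_def)
    also have "\<dots> = indicator (orthant ?J) t * emeasure lborel B"
      by (subst nn_integral_cmult) (auto simp: B_def)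
    also have "emeasure lborel B = ennreal (s - max Y X)"
      by (auto simp: B_def emeasure_lborel_Icc_eq ennreal_neg)
    finally show "(\<integral>\<^sup>+u. indicator A (t(a + r := u)) \<partial>lborel)
        = indicator (orthant ?J) t * ennreal (s - height a lo k r t)"
      unfolding height_def X_def Y_def .
  qed
  finally show ?thesis by (simp only: J A_def)
qed

text \<open>
  The height is the maximum over the chains that run through the first chain up to some element and
  continue with the elements \<open>j, \<dots>, r - 1\<close> (counted from \<open>0\<close>) of the second chain. Together with
  \<open>x_height_attained\<close>, this turns a bound on the height into one inequality for every such chain.
\<close>
lemma le_x_height:
  assumes "j < r"
  shows "(\<Sum>i<lo (Suc j). t i) + (\<Sum>i=j..<r. t (a + i)) \<le> x_height a lo t r"
  using assms
proof (induction r)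
  case (Suc r)
  show ?case
  proof (cases "j = r")
    case True
    then show ?thesis by simp
  next
    case False
    then have "(\<Sum>i<lo (Suc j). t i) + (\<Sum>i=j..<r. t (a + i)) \<le> x_height a lo t r"
      using Suc by simp
    with Suc.prems show ?thesis by simp
  qed
qed simp

lemma x_height_attained:
  assumes "0 < r" "\<And>i. i < lo 1 \<Longrightarrow> 0 \<le> t i"
  shows "\<exists>j<r. x_height a lo t r = (\<Sum>i<lo (Suc j). t i) + (\<Sum>i=j..<r. t (a + i))"
  using assms(1)
proof (induction r)
  case (Suc r)
  show ?case
  proof (cases "(\<Sum>i<lo (Suc r). t i) \<le> x_height a lo t r")
    case False
    then show ?thesis by (intro exI[of _ r]) auto
  next
    case True
    have "0 < r"
    proof (rule ccontr)
      assume "\<not> 0 < r"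
      then have "(\<Sum>i<lo 1. t i) \<le> -1" using True by simp
      moreover have "0 \<le> (\<Sum>i<lo 1. t i)" using assms(2) by (intro sum_nonneg) auto
      ultimately show False by simp
    qed
    from Suc.IH[OF this] obtain j where "j < r"
      "x_height a lo t r = (\<Sum>i<lo (Suc j). t i) + (\<Sum>i=j..<r. t (a + i))" by blast
    with True show ?thesis by (intro exI[of _ j]) simp
  qed
qed simp

lemma y_height_le_x_height:
  assumes "lo r = k" "0 < r" "t \<in> orthant (two_chains a k r)"
  shows "(\<Sum>i<k. t i) \<le> x_height a lo t r"
proof -
  obtain r' where r: "r = Suc r'" using assms(2) by (cases r) auto
  have "0 \<le> t (a + r')" using assms(3) by (auto simp: r orthant_def two_chains_def PiE_iff)
  then show ?thesis using assms(1) by (simp add: r)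
qed

lemma path_count_eq_0: "N k < r \<Longrightarrow> path_count N k r = 0"
  by (cases k; cases r) auto

lemma volume_split_by_last_step:
  "emeasure (\<Pi>\<^sub>M i\<in>two_chains a k r. lborel)
      {t \<in> orthant (two_chains a k r). height a lo k r t \<le> s}
    = emeasure (\<Pi>\<^sub>M i\<in>two_chains a k r. lborel)
      {t \<in> orthant (two_chains a k r). height a lo k r t \<le> s \<and> x_height a lo t r < (\<Sum>i<k. t i)}
    + emeasure (\<Pi>\<^sub>M i\<in>two_chains a k r. lborel)
      {t \<in> orthant (two_chains a k r). height a lo k r t \<le> s \<and> (\<Sum>i<k. t i) \<le> x_height a lo t r}"
  (is "emeasure ?M ?R = emeasure ?M ?A + emeasure ?M ?B")
proof -
  have A: "?A \<in> sets ?M" and B: "?B \<in> sets ?M"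
    by (rule sets_last_step)+
  have "?R = ?A \<union> ?B" "?A \<inter> ?B = {}" by auto
  with plus_emeasure[OF A B] show ?thesis by metis
qed

lemma sets_height_le:
  "{t \<in> orthant (two_chains a k r). height a lo k r t \<le> s} \<in> sets (\<Pi>\<^sub>M i\<in>two_chains a k r. (lborel :: real measure))"
proof -
  have "{t \<in> orthant (two_chains a k r). height a lo k r t \<le> s}
      = {t \<in> orthant (two_chains a k r). height a lo k r t \<le> s \<and> x_height a lo t r < (\<Sum>i<k. t i)}
      \<union> {t \<in> orthant (two_chains a k r). height a lo k r t \<le> s \<and> (\<Sum>i<k. t i) \<le> x_height a lo t r}"
    by auto
  then show ?thesis by (simp only: sets.Un sets_last_step)
qed

text \<open>
  The condition on \<open>lo\<close> is the Galois connection between the number \<open>lo r\<close> of elements below the \<open>r\<close>-th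
  element of the second chain and the number \<open>N k\<close> of elements that are not above the element
  following the first \<open>k\<close>. Under \<open>r \<le> N k\<close> the two initial segments form a down-closed set.
\<close>
theorem volume_two_chains:
  assumes lo: "\<And>r k. 1 \<le> r \<Longrightarrow> r \<le> b \<Longrightarrow> lo r \<le> k \<longleftrightarrow> r \<le> N k"
  shows "k \<le> a \<Longrightarrow> r \<le> b \<Longrightarrow> r \<le> N k \<Longrightarrow> 0 \<le> s \<Longrightarrow>
    emeasure (\<Pi>\<^sub>M i\<in>two_chains a k r. lborel)
      {t \<in> orthant (two_chains a k r). height a lo k r t \<le> s}
    = ennreal (real (path_count N k r) * s ^ (k + r) / fact (k + r))"
proof (induction "k + r" arbitrary: k r s)
  case 0
  interpret product_sigma_finite "\<lambda>_::nat. lborel :: real measure"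
    by standard
  have "{t \<in> orthant (two_chains a 0 0). height a lo 0 0 t \<le> s} = Pi\<^sub>E {} (\<lambda>_. UNIV)"
    using 0 by (auto simp: orthant_def two_chains_def height_def)
  then show ?case
    using 0 emeasure_PiM[of "{}" "\<lambda>_. UNIV"] by (simp add: two_chains_def)
next
  case (Suc n)
  let ?M = "\<lambda>k r. \<Pi>\<^sub>M i\<in>two_chains a k r. (lborel :: real measure)"
  let ?O = "\<lambda>k r. orthant (two_chains a k r)"
  interpret product_sigma_finite "\<lambda>_::nat. lborel :: real measure"
    by standard
  have lo_le: "lo j \<le> k'" if "1 \<le> j" "j \<le> r" "r \<le> N k'" for j k'
    using lo[of j k'] that \<open>r \<le> b\<close> by simp
  \<comment> \<open>Both cases for the element of largest height reduce to this integral, for the poset without it.\<close>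
  have layer: "(\<integral>\<^sup>+t. indicator (?O k' r') t * ennreal (s - height a lo k' r' t) \<partial>?M k' r')
      = ennreal (real (path_count N k' r') * s ^ Suc n / fact (Suc n))"
    if "n = k' + r'" "k' \<le> a" "r' \<le> b" "r' \<le> N k'" for k' r'
  proof (rule nn_integral_deficit_eq_power)
    show "sigma_finite_measure (?M k' r')" by (rule sigma_finite) simp
    show "?O k' r' \<in> sets (?M k' r')" by simp
    show "0 \<le> height a lo k' r' t" if "t \<in> ?O k' r'" for t
    proof -
      have "0 \<le> (\<Sum>i<k'. t i)"
        using that by (intro sum_nonneg) (auto simp: orthant_def two_chains_def PiE_iff)
      then show ?thesis by (simp add: height_def)
    qed
    show "emeasure (?M k' r') {t \<in> ?O k' r'. height a lo k' r' t \<le> v}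
        = ennreal (real (path_count N k' r') * v ^ n / fact n)" if "0 \<le> v" for v
      using Suc.hyps(1)[OF \<open>n = _\<close> \<open>k' \<le> a\<close> \<open>r' \<le> b\<close> \<open>r' \<le> N k'\<close> that] \<open>n = _\<close> by simp
  qed (use \<open>0 \<le> s\<close> in auto)

  define cN where "cN = (case k of 0 \<Rightarrow> 0 | Suc k' \<Rightarrow> path_count N k' r)"
  define cE where "cE = (case r of 0 \<Rightarrow> 0 | Suc r' \<Rightarrow> path_count N k r')"
  have North: "emeasure (?M k r) {t \<in> ?O k r. height a lo k r t \<le> s \<and> x_height a lo t r < (\<Sum>i<k. t i)}
      = ennreal (real cN * s ^ Suc n / fact (Suc n))"
  proof (cases "\<exists>k'. k = Suc k' \<and> r \<le> N k'")
    case True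
    then obtain k' where k': "k = Suc k'" "r \<le> N k'" by blast
    have "emeasure (?M k r) {t \<in> ?O k r. height a lo k r t \<le> s \<and> x_height a lo t r < (\<Sum>i<k. t i)}
        = (\<integral>\<^sup>+t. indicator (?O k' r) t * ennreal (s - height a lo k' r t) \<partial>?M k' r)"
      unfolding k'(1) using Suc.prems k' lo_le by (intro volume_last_step_North) auto
    also have "\<dots> = ennreal (real cN * s ^ Suc n / fact (Suc n))"
      using layer[of k' r] Suc k' by (simp add: cN_def del: fact_Suc)
    finally show ?thesis .
  next
    case False
    have "cN = 0"
      using False path_count_eq_0[of N _ r] by (auto simp: cN_def split: nat.split)
    have "0 < r"
      using False Suc.hyps(2) by (cases k) auto
    \<comment> \<open>Either the first chain is empty, or removing its last element would not leave a down-closed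
      set. In both cases the last element of the second chain lies above the whole first chain.\<close>
    have "lo r = k"
    proof (cases k)
      case 0
      then show ?thesis using lo_le[of r k] \<open>0 < r\<close> Suc.prems by simp
    next
      case k: (Suc k')
      then have "\<not> lo r \<le> k'" using False lo[of r k'] \<open>0 < r\<close> Suc.prems by simp
      then show ?thesis using lo_le[of r k] \<open>0 < r\<close> Suc.prems k by simp
    qed
    then have empty: "{t \<in> ?O k r. height a lo k r t \<le> s \<and> x_height a lo t r < (\<Sum>i<k. t i)} = {}"
      using y_height_le_x_height[OF _ \<open>0 < r\<close>] by fastforce
    show ?thesis unfolding empty by (simp add: \<open>cN = 0\<close>)
  qed
  have East: "emeasure (?M k r) {t \<in> ?O k r. height a lo k r t \<le> s \<and> (\<Sum>i<k. t i) \<le> x_height a lo t r}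
      = ennreal (real cE * s ^ Suc n / fact (Suc n))"
  proof (cases r)
    case 0
    have "0 \<le> (\<Sum>i<k. t i)" if "t \<in> ?O k r" for t
      using that by (intro sum_nonneg) (auto simp: orthant_def two_chains_def PiE_iff)
    then have empty: "{t \<in> ?O k r. height a lo k r t \<le> s \<and> (\<Sum>i<k. t i) \<le> x_height a lo t r} = {}"
      using 0 by force
    show ?thesis unfolding empty by (simp add: cE_def 0)
  next
    case r: (Suc r')
    have "emeasure (?M k r) {t \<in> ?O k r. height a lo k r t \<le> s \<and> (\<Sum>i<k. t i) \<le> x_height a lo t r}
        = (\<integral>\<^sup>+t. indicator (?O k r') t * ennreal (s - height a lo k r' t) \<partial>?M k r')"
      unfolding r using Suc.prems r lo_le by (intro volume_last_step_East) auto
    also have "\<dots> = ennreal (real cE * s ^ Suc n / fact (Suc n))"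
      using layer[of k r'] Suc r by (simp add: cE_def del: fact_Suc)
    finally show ?thesis .
  qed
  have count: "path_count N k r = cN + cE"
    using Suc.hyps(2) Suc.prems by (cases k; cases r) (auto simp: cN_def cE_def)
  have "emeasure (?M k r) {t \<in> ?O k r. height a lo k r t \<le> s}
      = ennreal (real cN * s ^ Suc n / fact (Suc n)) + ennreal (real cE * s ^ Suc n / fact (Suc n))"
    unfolding volume_split_by_last_step[of a k r lo s] North East ..
  also have "\<dots> = ennreal (real cN * s ^ Suc n / fact (Suc n) + real cE * s ^ Suc n / fact (Suc n))"
    using \<open>0 \<le> s\<close> by (intro ennreal_plus[symmetric]) auto
  also have "real cN * s ^ Suc n / fact (Suc n) + real cE * s ^ Suc n / fact (Suc n)
      = real (path_count N k r) * s ^ (k + r) / fact (k + r)"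
    unfolding Suc.hyps(2)[symmetric] count by (simp add: add_divide_distrib[symmetric] distrib_right)
  finally show ?case .
qed


section \<open>Counting paths above a given path\<close>

abbreviation partial_sum :: "(nat \<Rightarrow> nat) \<Rightarrow> nat \<Rightarrow> nat" where
  "partial_sum \<nu> k \<equiv> \<Sum>i=1..k. \<nu> i"

lemma mono_partial_sum: "mono (partial_sum \<nu>)"
  by (intro monoI sum_mono2) auto

lemma endpoint_Nil [simp]: "endpoint [] = (0, 0)"
  by (simp add: endpoint_def)

lemma endpoint_snoc [simp]:
  "endpoint (p @ [North]) = (fst (endpoint p), Suc (snd (endpoint p)))"
  "endpoint (p @ [East]) = (Suc (fst (endpoint p)), snd (endpoint p))"
  by (simp_all add: endpoint_def)

lemma path_points_Nil [simp]: "path_points [] = {(0, 0)}"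
  by (simp add: path_points_def)

lemma path_points_snoc [simp]:
  "path_points (p @ [s]) = insert (endpoint (p @ [s])) (path_points p)"
proof -
  have "{k. k \<le> length (p @ [s])} = insert (length (p @ [s])) {k. k \<le> length p}" by auto
  moreover have "path_points q = (\<lambda>k. endpoint (take k q)) ` {k. k \<le> length q}" for q
    by (auto simp: path_points_def)
  ultimately show ?thesis by auto
qed

lemma endpoint_in_path_points: "endpoint p \<in> path_points p"
  by (auto simp: path_points_def intro!: exI[of _ "length p"])

lemma path_points_le_endpoint:
  assumes "(x, y) \<in> path_points p"
  shows "y \<le> snd (endpoint p)"
proof -
  obtain k where "(x, y) = endpoint (take k p)"
    using assms by (auto simp: path_points_def)
  then have "y = count_list (take k p) North"
    by (auto simp: endpoint_def)
  moreover have "count_list (take k p) North \<le> count_list p North"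
    using count_list_append[of "take k p" "drop k p" North] by simp
  ultimately show ?thesis
    by (simp add: endpoint_def)
qed

lemma append_East_Suc: "p @ replicate (Suc n) East = (p @ replicate n East) @ [East]"
  by (simp add: replicate_append_same)

lemma endpoint_append_East:
  "endpoint (p @ replicate n East) = (fst (endpoint p) + n, snd (endpoint p))"
proof (induction n)
  case (Suc n)
  then show ?case unfolding append_East_Suc endpoint_snoc by simp
qed simp

lemma path_points_append_East:
  "path_points (p @ replicate n East)
    = path_points p \<union> {(fst (endpoint p) + j, snd (endpoint p)) | j. j \<le> n}"
proof (induction n)
  case 0
  then show ?case using endpoint_in_path_points[of p] by auto
next
  case (Suc n)
  have "path_points (p @ replicate (Suc n) East)
      = insert (fst (endpoint p) + Suc n, snd (endpoint p)) (path_points (p @ replicate n East))"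
    unfolding append_East_Suc path_points_snoc endpoint_snoc endpoint_append_East by simp
  with Suc show ?case by (auto simp: le_Suc_eq)
qed

lemma path_of_Suc: "path_of (Suc a) \<nu> = (path_of a \<nu> @ [North]) @ replicate (\<nu> (Suc a)) East"
  by (simp add: path_of_def)

lemma endpoint_path_of: "endpoint (path_of a \<nu>) = (partial_sum \<nu> a, a)"
proof (induction a)
  case 0
  then show ?case by (simp add: path_of_def)
next
  case (Suc a)
  then show ?case unfolding path_of_Suc endpoint_append_East by simp
qed

text \<open>
  At level \<open>y > 0\<close> the path runs from abscissa \<open>N (y - 1)\<close> to \<open>N y\<close>, where \<open>N\<close> is \<open>partial_sum \<nu>\<close>. For \<open>y = 0\<close>,
  truncated subtraction makes both bounds \<open>N 0 = 0\<close>.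
\<close>
lemma path_points_path_of:
  "path_points (path_of a \<nu>)
    = {(x, y). y \<le> a \<and> partial_sum \<nu> (y - 1) \<le> x \<and> x \<le> partial_sum \<nu> y}"
proof (induction a)
  case 0
  then show ?case by (auto simp: path_of_def)
next
  case (Suc a)
  let ?N = "partial_sum \<nu>"
  have "path_points (path_of (Suc a) \<nu>)
      = insert (?N a, Suc a) (path_points (path_of a \<nu>)) \<union> {(?N a + j, Suc a) | j. j \<le> \<nu> (Suc a)}"
    unfolding path_of_Suc path_points_append_East by (simp add: endpoint_path_of)
  also have "{(?N a + j, Suc a) | j. j \<le> \<nu> (Suc a)} = {(x, Suc a) | x. ?N a \<le> x \<and> x \<le> ?N (Suc a)}"
  proof safe
    fix x assume "?N a \<le> x" "x \<le> ?N (Suc a)"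
    then show "\<exists>j. (x, Suc a) = (?N a + j, Suc a) \<and> j \<le> \<nu> (Suc a)"
      by (intro exI[of _ "x - ?N a"]) auto
  qed auto
  finally show ?case unfolding Suc by (auto simp: le_Suc_eq)
qed

definition paths_below :: "(nat \<Rightarrow> nat) \<Rightarrow> nat \<Rightarrow> nat \<Rightarrow> lattice_path set" where
  "paths_below N k r = {p. endpoint p = (r, k) \<and> (\<forall>(x, y) \<in> path_points p. x \<le> N y)}"

text \<open>
  A point \<open>(x, y)\<close> lies weakly above the path if and only if \<open>x \<le> N y\<close>, where \<open>N\<close> is \<open>partial_sum \<nu>\<close>: the lowest point of the path on
  the vertical line at \<open>x\<close> is at the least level \<open>y'\<close> with \<open>x \<le> N y'\<close>.
\<close>
lemma Dyck_paths_path_of: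
  "Dyck_paths (path_of a \<nu>) = paths_below (partial_sum \<nu>) a (partial_sum \<nu> a)"
proof -
  let ?N = "partial_sum \<nu>"
  have above: "(\<exists>y'. (x, y') \<in> path_points (path_of a \<nu>) \<and> y' \<le> y) \<longleftrightarrow> x \<le> ?N y" if "y \<le> a" for x y
  proof
    assume "\<exists>y'. (x, y') \<in> path_points (path_of a \<nu>) \<and> y' \<le> y"
    then obtain y' where "y' \<le> y" "x \<le> ?N y'" by (auto simp: path_points_path_of)
    then show "x \<le> ?N y" using monoD[OF mono_partial_sum[of \<nu>], of y' y] by simp
  next
    assume "x \<le> ?N y"
    define y' where "y' = (LEAST y. x \<le> ?N y)"
    have y': "x \<le> ?N y'" "y' \<le> y"
      unfolding y'_def using \<open>x \<le> ?N y\<close> by (rule LeastI, rule Least_le)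
    have "?N (y' - 1) \<le> x"
    proof (cases y')
      case (Suc k)
      then have "\<not> x \<le> ?N k" using not_less_Least[of k "\<lambda>y. x \<le> ?N y"] by (simp add: y'_def)
      then show ?thesis by (simp add: Suc)
    qed simp
    then show "\<exists>y'. (x, y') \<in> path_points (path_of a \<nu>) \<and> y' \<le> y"
      using y' \<open>y \<le> a\<close> by (intro exI[of _ y']) (simp add: path_points_path_of)
  qed
  have "weakly_above p (path_of a \<nu>) \<longleftrightarrow> (\<forall>(x, y) \<in> path_points p. x \<le> ?N y)"
    if "endpoint p = (?N a, a)" for p
    unfolding weakly_above_def
  proof (rule ball_cong[OF refl])
    fix z assume z: "z \<in> path_points p"
    obtain x y where xy: "z = (x, y)" by (cases z)
    then have "y \<le> a" using path_points_le_endpoint[of x y p] z that by simp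
    then show "(case z of (x, y) \<Rightarrow> \<exists>y'. (x, y') \<in> path_points (path_of a \<nu>) \<and> y' \<le> y)
        \<longleftrightarrow> (case z of (x, y) \<Rightarrow> x \<le> ?N y)"
      unfolding xy prod.case by (rule above)
  qed
  then show ?thesis
    unfolding Dyck_paths_def paths_below_def endpoint_path_of by blast
qed

lemma paths_below_0_0: "paths_below N 0 0 = {[]}"
proof -
  have "p = []" if "endpoint p = (0, 0)" for p
  proof (cases p rule: rev_cases)
    case (snoc q s)
    with that show ?thesis by (cases s) auto
  qed
  then show ?thesis by (auto simp: paths_below_def)
qed

lemma paths_below_snoc:
  "p @ [North] \<in> paths_below N k r \<longleftrightarrow> r \<le> N k \<and> (\<exists>k'. k = Suc k' \<and> p \<in> paths_below N k' r)"
  "p @ [East] \<in> paths_below N k r \<longleftrightarrow> r \<le> N k \<and> (\<exists>r'. r = Suc r' \<and> p \<in> paths_below N k r')"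
  by (auto simp: paths_below_def prod_eq_iff)

lemma paths_below_last_step:
  assumes "(k, r) \<noteq> (0, 0)"
  shows "paths_below N k r = (if r \<le> N k then
      (\<lambda>p. p @ [North]) ` (case k of 0 \<Rightarrow> {} | Suc k' \<Rightarrow> paths_below N k' r)
      \<union> (\<lambda>p. p @ [East]) ` (case r of 0 \<Rightarrow> {} | Suc r' \<Rightarrow> paths_below N k r') else {})"
    (is "?L = ?R")
proof (rule set_eqI)
  fix p
  show "p \<in> ?L \<longleftrightarrow> p \<in> ?R"
  proof (cases p rule: rev_cases)
    case Nil
    then show ?thesis using assms by (auto simp: paths_below_def)
  next
    case (snoc q s)
    then show ?thesis
      by (cases s) (auto simp: paths_below_snoc split: nat.split)
  qed
qed

lemma inj_snoc: "inj_on (\<lambda>p. p @ [s]) A"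
  by (simp add: inj_on_def)

lemma card_paths_below: "finite (paths_below N k r) \<and> card (paths_below N k r) = path_count N k r"
proof (induction N k r rule: path_count.induct)
  case (1 N)
  then show ?case by (simp add: paths_below_0_0)
next
  case (2 N r)
  then show ?case by (subst (1 2) paths_below_last_step) (auto simp: card_image[OF inj_snoc])
next
  case (3 N k)
  then show ?case by (subst (1 2) paths_below_last_step) (auto simp: card_image[OF inj_snoc])
next
  case (4 N k r)
  show ?case
  proof (cases "Suc r \<le> N (Suc k)")
    case True
    note IH = "4.IH"[OF True]
    have "paths_below N (Suc k) (Suc r) = (\<lambda>p. p @ [North]) ` paths_below N k (Suc r)
        \<union> (\<lambda>p. p @ [East]) ` paths_below N (Suc k) r"
      using True by (subst paths_below_last_step) auto
    moreover have "(\<lambda>p. p @ [North]) ` paths_below N k (Suc r)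
        \<inter> (\<lambda>p. p @ [East]) ` paths_below N (Suc k) r = {}"
      by auto
    ultimately show ?thesis
      using IH True by (simp add: card_Un_disjoint card_image[OF inj_snoc])
  next
    case False
    then show ?thesis by (subst (1 2) paths_below_last_step) auto
  qed
qed

lemma Cat_path_of:
  "Cat (path_of a \<nu>) = path_count (partial_sum \<nu>) a (partial_sum \<nu> a)"
  by (simp add: Cat_def Dyck_paths_path_of card_paths_below)


section \<open>Flows on the caracol graph\<close>

text \<open>The level of the \<open>r\<close>-th east step of the path, counted from \<open>1\<close>.\<close>
definition east_level :: "(nat \<Rightarrow> nat) \<Rightarrow> nat \<Rightarrow> nat" where
  "east_level \<nu> r = (LEAST k. r \<le> partial_sum \<nu> k)"

lemma east_level_le_iff:
  assumes "r \<le> partial_sum \<nu> a"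
  shows "east_level \<nu> r \<le> k \<longleftrightarrow> r \<le> partial_sum \<nu> k"
proof
  assume "east_level \<nu> r \<le> k"
  moreover have "r \<le> partial_sum \<nu> (east_level \<nu> r)"
    unfolding east_level_def using assms by (rule LeastI)
  ultimately show "r \<le> partial_sum \<nu> k"
    using monoD[OF mono_partial_sum] by (meson order_trans)
qed (simp add: east_level_def Least_le)

lemma east_level_bounds:
  assumes "r < partial_sum \<nu> a"
  defines "i \<equiv> east_level \<nu> (Suc r)"
  shows "1 \<le> i" "i \<le> a" "partial_sum \<nu> (i - 1) \<le> r" "r < partial_sum \<nu> i"
proof -
  note iff = east_level_le_iff[of "Suc r" \<nu> a, folded i_def]
  show "1 \<le> i" "i \<le> a" "r < partial_sum \<nu> i"
    using iff[of 0] iff[of a] iff[of i] assms by auto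
  then show "partial_sum \<nu> (i - 1) \<le> r"
    using iff[of "i - 1"] assms by auto
qed

lemma east_level_eqI:
  assumes "1 \<le> i" "partial_sum \<nu> (i - 1) \<le> r" "r < partial_sum \<nu> i"
  shows "east_level \<nu> (Suc r) = i"
proof -
  note iff = east_level_le_iff[of "Suc r" \<nu> i]
  have "east_level \<nu> (Suc r) \<le> i" "\<not> east_level \<nu> (Suc r) \<le> i - 1"
    using iff[of i] iff[of "i - 1"] assms by auto
  then show ?thesis using assms(1) by simp
qed

text \<open>
  The arcs carrying the free coordinates: an index below \<open>a\<close> stands for an arc into the sink
  \<open>a + 3\<close>, and the index \<open>a + r\<close> for the arc out of the source that belongs to the \<open>r\<close>-th east step,
  counted from \<open>0\<close>. The east steps on the same level yield parallel arcs.
\<close>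
definition coord_arc :: "nat \<Rightarrow> (nat \<Rightarrow> nat) \<Rightarrow> nat \<Rightarrow> arc" where
  "coord_arc a \<nu> n = (if n < a then (n + 2, a + 3, 0)
    else let i = east_level \<nu> (Suc (n - a)) in (1, i + 2, n - a - partial_sum \<nu> (i - 1)))"

definition chain_arc :: "nat \<Rightarrow> arc" where
  "chain_arc k = (k + 1, k + 2, 0)"

text \<open>
  The free coordinates of the arcs that leave the cut between the vertices \<open>1, \<dots>, k + 1\<close> and the others
  without using the arc \<open>(k + 1, k + 2)\<close>: arcs into the sink from a vertex up to \<open>k + 1\<close>, and arcs out
  of the source to a vertex beyond \<open>k + 1\<close>, which have level at least \<open>k\<close>. For \<open>k = 0\<close> the truncated
  \<open>k - 1\<close> is harmless, as the partial sums up to \<open>0\<close> and up to \<open>-1\<close> are both empty.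
\<close>
definition chain_coords :: "nat \<Rightarrow> (nat \<Rightarrow> nat) \<Rightarrow> nat \<Rightarrow> nat set" where
  "chain_coords a \<nu> k = {..<min k a} \<union> {a + partial_sum \<nu> (k - 1)..<a + partial_sum \<nu> a}"

lemma coord_arc_North [simp]: "n < a \<Longrightarrow> coord_arc a \<nu> n = (n + 2, a + 3, 0)"
  by (simp add: coord_arc_def)

lemma coord_arc_East:
  assumes "1 \<le> i" "k < \<nu> i"
  shows "coord_arc a \<nu> (a + partial_sum \<nu> (i - 1) + k) = (1, i + 2, k)"
proof -
  have "partial_sum \<nu> i = partial_sum \<nu> (i - 1) + \<nu> i"
    using assms(1) by (cases i) auto
  then have "east_level \<nu> (Suc (partial_sum \<nu> (i - 1) + k)) = i"
    using assms by (intro east_level_eqI) auto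
  then show ?thesis by (simp add: coord_arc_def add.assoc)
qed

lemma coord_arc_East_image:
  assumes "1 \<le> i"
  shows "coord_arc a \<nu> ` {a + partial_sum \<nu> (i - 1)..<a + partial_sum \<nu> i}
    = {(1, i + 2, k) | k. k < \<nu> i}"
proof -
  have "partial_sum \<nu> i = partial_sum \<nu> (i - 1) + \<nu> i"
    using assms(1) by (cases i) auto
  then have "{a + partial_sum \<nu> (i - 1)..<a + partial_sum \<nu> i}
      = (\<lambda>k. a + partial_sum \<nu> (i - 1) + k) ` {..<\<nu> i}"
    by (auto simp: lessThan_atLeast0)
  also have "coord_arc a \<nu> ` \<dots> = (\<lambda>k. (1, i + 2, k)) ` {..<\<nu> i}"
    unfolding image_image using coord_arc_East[OF assms] by (intro image_cong) auto
  finally show ?thesis by auto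
qed

lemma coord_arc_ge:
  assumes "a \<le> n" "n < a + partial_sum \<nu> a"
  shows "\<exists>i k. 1 \<le> i \<and> i \<le> a \<and> k < \<nu> i \<and> n = a + partial_sum \<nu> (i - 1) + k
    \<and> coord_arc a \<nu> n = (1, i + 2, k)"
proof -
  define i where "i = east_level \<nu> (Suc (n - a))"
  have i: "1 \<le> i" "i \<le> a" "partial_sum \<nu> (i - 1) \<le> n - a" "n - a < partial_sum \<nu> i"
    using east_level_bounds[of "n - a" \<nu> a] assms by (auto simp: i_def)
  have "partial_sum \<nu> i = partial_sum \<nu> (i - 1) + \<nu> i"
    using i(1) by (cases i) auto
  then have k: "n - a - partial_sum \<nu> (i - 1) < \<nu> i"
      "n = a + partial_sum \<nu> (i - 1) + (n - a - partial_sum \<nu> (i - 1))"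
    using i assms by auto
  show ?thesis
    using i(1,2) k coord_arc_East[of i _ \<nu> a, OF i(1) k(1)] by metis
qed

lemma inj_on_coord_arc: "inj_on (coord_arc a \<nu>) {..<a + partial_sum \<nu> a}"
proof (rule inj_onI)
  fix m n assume mn: "m \<in> {..<a + partial_sum \<nu> a}" "n \<in> {..<a + partial_sum \<nu> a}"
    and eq: "coord_arc a \<nu> m = coord_arc a \<nu> n"
  consider "m < a" "n < a" | "m < a" "a \<le> n" | "a \<le> m" "n < a" | "a \<le> m" "a \<le> n" by linarith
  then show "m = n"
  proof cases
    case 1
    then show ?thesis using eq by simp
  next
    case 2
    obtain i k where "coord_arc a \<nu> n = (1, i + 2, k)"
      using coord_arc_ge[of a n \<nu>] 2 mn by auto
    then show ?thesis using eq 2 by simp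
  next
    case 3
    obtain i k where "coord_arc a \<nu> m = (1, i + 2, k)"
      using coord_arc_ge[of a m \<nu>] 3 mn by auto
    then show ?thesis using eq 3 by simp
  next
    case 4
    obtain i k where m: "m = a + partial_sum \<nu> (i - 1) + k" "coord_arc a \<nu> m = (1, i + 2, k)"
      using coord_arc_ge[of a m \<nu>] 4 mn by auto
    obtain i' k' where n: "n = a + partial_sum \<nu> (i' - 1) + k'" "coord_arc a \<nu> n = (1, i' + 2, k')"
      using coord_arc_ge[of a n \<nu>] 4 mn by auto
    show ?thesis using eq m n by simp
  qed
qed

lemma coord_arc_neq_chain_arc:
  assumes "n < a + partial_sum \<nu> a" "k \<le> a + 1"
  shows "coord_arc a \<nu> n \<noteq> chain_arc k"
proof (cases "n < a")
  case False
  then obtain i k where "1 \<le> i" "coord_arc a \<nu> n = (1, i + 2, k)"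
    using coord_arc_ge[of a n \<nu>] assms(1) by auto
  then show ?thesis by (auto simp: chain_arc_def)
qed (auto simp: chain_arc_def)

lemma inj_chain_arc: "inj chain_arc"
  by (auto simp: inj_def chain_arc_def)

lemma arcs_car:
  "arcs (car a \<nu>) = coord_arc a \<nu> ` {..<a + partial_sum \<nu> a} \<union> chain_arc ` {..a + 1}"
proof -
  have "{(1, i + 2, k) | i k. i \<in> {1..a} \<and> k < \<nu> i} = coord_arc a \<nu> ` {a..<a + partial_sum \<nu> a}"
  proof (intro equalityI subsetI)
    fix e :: arc assume "e \<in> {(1, i + 2, k) | i k. i \<in> {1..a} \<and> k < \<nu> i}"
    then obtain i k where e: "e = (1, i + 2, k)" and i: "1 \<le> i" "i \<le> a" "k < \<nu> i"
      by auto
    then have "partial_sum \<nu> i = partial_sum \<nu> (i - 1) + \<nu> i" by (cases i) auto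
    then have "partial_sum \<nu> (i - 1) + k < partial_sum \<nu> a"
      using i monoD[OF mono_partial_sum[of \<nu>], of i a] by simp
    then show "e \<in> coord_arc a \<nu> ` {a..<a + partial_sum \<nu> a}"
      unfolding e coord_arc_East[of i k \<nu> a, OF i(1,3), symmetric] by (intro imageI) simp
  next
    fix e assume "e \<in> coord_arc a \<nu> ` {a..<a + partial_sum \<nu> a}"
    then obtain n where "e = coord_arc a \<nu> n" "a \<le> n" "n < a + partial_sum \<nu> a" by auto
    then show "e \<in> {(1, i + 2, k) | i k. i \<in> {1..a} \<and> k < \<nu> i}"
      using coord_arc_ge[of a n \<nu>] by auto
  qed
  moreover have "{(i, a + 3, 0) | i. i \<in> {2..a + 1}} = coord_arc a \<nu> ` {..<a}"
  proof -
    have "coord_arc a \<nu> ` {..<a} = (\<lambda>n. (n + 2, a + 3, 0)) ` {..<a}"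
      by (intro image_cong) auto
    also have "\<dots> = {(i, a + 3, 0) | i. i \<in> {2..a + 1}}"
    proof safe
      fix i assume "i \<in> {2..a + 1}"
      then show "(i, a + 3, 0) \<in> (\<lambda>n. (n + 2, a + 3, 0)) ` {..<a}"
        by (intro image_eqI[of _ _ "i - 2"]) auto
    qed auto
    finally show ?thesis ..
  qed
  moreover have "{(i, i + 1, 0) | i. i \<in> {1..a + 2}} = chain_arc ` {..a + 1}"
  proof safe
    fix i :: nat assume "i \<in> {1..a + 2}"
    then show "(i, i + 1, 0) \<in> chain_arc ` {..a + 1}"
      by (intro image_eqI[of _ _ "i - 1"]) (auto simp: chain_arc_def)
  qed (auto simp: chain_arc_def)
  moreover have "{..<a + partial_sum \<nu> a} = {a..<a + partial_sum \<nu> a} \<union> {..<a}" by auto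
  ultimately show ?thesis
    unfolding car_def by (simp only: pre_digraph.simps image_Un Un_assoc)
qed

lemma out_arcs_car_source:
  "out_arcs (car a \<nu>) 1 = insert (chain_arc 0) (coord_arc a \<nu> ` {a..<a + partial_sum \<nu> a})"
proof -
  have "tail (car a \<nu>) (coord_arc a \<nu> n) = 1 \<longleftrightarrow> a \<le> n" if n: "n < a + partial_sum \<nu> a" for n
  proof (cases "n < a")
    case False
    then obtain i k where "coord_arc a \<nu> n = (1, i + 2, k)"
      using coord_arc_ge[of a n \<nu>] n by auto
    with False show ?thesis by (simp add: car_def)
  qed (simp add: car_def)
  then have coord: "{n \<in> {..<a + partial_sum \<nu> a}. tail (car a \<nu>) (coord_arc a \<nu> n) = 1}
      = {a..<a + partial_sum \<nu> a}"
    by auto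
  have chain: "{j \<in> {..a + 1}. tail (car a \<nu>) (chain_arc j) = 1} = {0}"
    by (auto simp: car_def chain_arc_def)
  have "out_arcs (car a \<nu>) 1
      = coord_arc a \<nu> ` {n \<in> {..<a + partial_sum \<nu> a}. tail (car a \<nu>) (coord_arc a \<nu> n) = 1}
        \<union> chain_arc ` {j \<in> {..a + 1}. tail (car a \<nu>) (chain_arc j) = 1}"
    unfolding out_arcs_def arcs_car by blast
  then show ?thesis unfolding coord chain by auto
qed

lemma out_arcs_car:
  assumes "1 \<le> k" "k \<le> a + 1"
  shows "out_arcs (car a \<nu>) (k + 1)
    = insert (chain_arc k) (if k \<le> a then {coord_arc a \<nu> (k - 1)} else {})"
proof -
  have "tail (car a \<nu>) (coord_arc a \<nu> n) = k + 1 \<longleftrightarrow> k \<le> a \<and> n = k - 1"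
    if n: "n < a + partial_sum \<nu> a" for n
  proof (cases "n < a")
    case False
    then obtain i k' where "coord_arc a \<nu> n = (1, i + 2, k')"
      using coord_arc_ge[of a n \<nu>] n by auto
    with False assms show ?thesis by (auto simp: car_def)
  qed (use assms in \<open>auto simp: car_def\<close>)
  then have coord: "{n \<in> {..<a + partial_sum \<nu> a}. tail (car a \<nu>) (coord_arc a \<nu> n) = k + 1}
      = (if k \<le> a then {k - 1} else {})"
    using assms by auto (simp add: car_def)
  have chain: "{j \<in> {..a + 1}. tail (car a \<nu>) (chain_arc j) = k + 1} = {k}"
    using assms by (auto simp: car_def chain_arc_def)
  have "out_arcs (car a \<nu>) (k + 1)
      = coord_arc a \<nu> ` {n \<in> {..<a + partial_sum \<nu> a}. tail (car a \<nu>) (coord_arc a \<nu> n) = k + 1}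
        \<union> chain_arc ` {j \<in> {..a + 1}. tail (car a \<nu>) (chain_arc j) = k + 1}"
    unfolding out_arcs_def arcs_car by blast
  then show ?thesis unfolding coord chain by auto
qed

lemma in_arcs_car:
  assumes "1 \<le> k" "k \<le> a + 1"
  shows "in_arcs (car a \<nu>) (k + 1) = insert (chain_arc (k - 1))
    (coord_arc a \<nu> ` {a + partial_sum \<nu> (k - 2)..<a + partial_sum \<nu> (k - 1)})"
proof -
  have "coord_arc a \<nu> ` {a + partial_sum \<nu> (k - 2)..<a + partial_sum \<nu> (k - 1)}
      = {(1, k + 1, i) | i. 2 \<le> k \<and> i < \<nu> (k - 1)}"
  proof (cases "2 \<le> k")
    case True
    then have "k - 1 - 1 = k - 2" "k - 1 + 2 = k + 1" by auto
    with True coord_arc_East_image[of "k - 1" a \<nu>] show ?thesis by simp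
  next
    case False
    then have "k = 1" using assms by simp
    then show ?thesis by simp
  qed
  moreover have "in_arcs (car a \<nu>) (k + 1)
      = insert (chain_arc (k - 1)) {(1, k + 1, i) | i. 2 \<le> k \<and> i < \<nu> (k - 1)}"
  proof (rule set_eqI)
    fix e :: arc
    obtain u v w where e: "e = (u, v, w)" by (cases e) auto
    show "e \<in> in_arcs (car a \<nu>) (k + 1)
        \<longleftrightarrow> e \<in> insert (chain_arc (k - 1)) {(1, k + 1, i) | i. 2 \<le> k \<and> i < \<nu> (k - 1)}"
      using assms unfolding e in_arcs_def car_def chain_arc_def
      by (auto intro!: exI[of _ "k - 1"])
  qed
  ultimately show ?thesis by simp
qed

lemma sum_chain_coords:
  fixes f :: "nat \<Rightarrow> real"
  shows "(\<Sum>n\<in>chain_coords a \<nu> k. f n)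
    = (\<Sum>n<min k a. f n) + (\<Sum>n=a + partial_sum \<nu> (k - 1)..<a + partial_sum \<nu> a. f n)"
  unfolding chain_coords_def by (rule sum.union_disjoint) auto

text \<open>
  The conservation laws say that the total flow across each of the cuts after the vertex \<open>k + 1\<close>
  is \<open>1\<close>. The equation at the source is the cut \<open>k = 0\<close>, and the equation at \<open>k + 1\<close> is the difference
  of the cuts \<open>k\<close> and \<open>k - 1\<close>.
\<close>
lemma flow_polytope_car:
  "x \<in> flow_polytope (a + 2) (car a \<nu>) \<longleftrightarrow>
    Poly_Mapping.keys x \<subseteq> arcs (car a \<nu>) \<and> (\<forall>e \<in> arcs (car a \<nu>). 0 \<le> Poly_Mapping.lookup x e) \<and>
    (\<forall>k \<le> a + 1. Poly_Mapping.lookup x (chain_arc k)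
      + (\<Sum>n\<in>chain_coords a \<nu> k. Poly_Mapping.lookup x (coord_arc a \<nu> n)) = 1)"
proof -
  define f where "f n = Poly_Mapping.lookup x (coord_arc a \<nu> n)" for n
  define z where "z k = Poly_Mapping.lookup x (chain_arc k)" for k
  define T where "T k = z k + (\<Sum>n\<in>chain_coords a \<nu> k. f n)" for k
  let ?x = "Poly_Mapping.lookup x"
  have sum_coord: "(\<Sum>e\<in>coord_arc a \<nu> ` A. ?x e) = sum f A"
    if "A \<subseteq> {..<a + partial_sum \<nu> a}" for A
    unfolding f_def using inj_on_subset[OF inj_on_coord_arc that] by (simp add: sum.reindex)
  have sum_insert: "(\<Sum>e\<in>insert (chain_arc k) (coord_arc a \<nu> ` A). ?x e) = z k + sum f A"
    if "A \<subseteq> {..<a + partial_sum \<nu> a}" "k \<le> a + 1" for A k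
  proof -
    have "chain_arc k \<notin> coord_arc a \<nu> ` A"
      using coord_arc_neq_chain_arc[of _ a \<nu> k] that by force
    moreover have "finite A" using that(1) by (rule finite_subset) simp
    ultimately show ?thesis
      using sum_coord[OF that(1)] by (simp add: z_def)
  qed
  have source: "(\<Sum>e\<in>out_arcs (car a \<nu>) 1. ?x e) = T 0"
    unfolding out_arcs_car_source T_def sum_chain_coords by (subst sum_insert) auto
  have step: "(\<Sum>e\<in>out_arcs (car a \<nu>) (k + 1). ?x e) - (\<Sum>e\<in>in_arcs (car a \<nu>) (k + 1). ?x e)
      = T k - T (k - 1)" if k: "1 \<le> k" "k \<le> a + 1" for k
  proof -
    define R where "R = {a + partial_sum \<nu> (k - 2)..<a + partial_sum \<nu> (k - 1)}"
    have mono: "partial_sum \<nu> (k - 2) \<le> partial_sum \<nu> (k - 1)" "partial_sum \<nu> (k - 1) \<le> partial_sum \<nu> a"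
      using k monoD[OF mono_partial_sum[of \<nu>], of "k - 2" "k - 1"]
        monoD[OF mono_partial_sum[of \<nu>], of "k - 1" a] by auto
    have "(if k \<le> a then {coord_arc a \<nu> (k - 1)} else {}) = coord_arc a \<nu> ` (if k \<le> a then {k - 1} else {})"
      by simp
    then have out: "(\<Sum>e\<in>out_arcs (car a \<nu>) (k + 1). ?x e) = z k + (if k \<le> a then f (k - 1) else 0)"
      unfolding out_arcs_car[OF k] by (simp only:) (subst sum_insert, use k in auto)
    have "in_arcs (car a \<nu>) (k + 1) = insert (chain_arc (k - 1)) (coord_arc a \<nu> ` R)"
      unfolding R_def by (rule in_arcs_car[OF k])
    then have in_: "(\<Sum>e\<in>in_arcs (car a \<nu>) (k + 1). ?x e) = z (k - 1) + sum f R"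
      by (simp only:) (subst sum_insert, use k mono in \<open>auto simp: R_def\<close>)
    have North: "(\<Sum>n<min k a. f n) = (\<Sum>n<min (k - 1) a. f n) + (if k \<le> a then f (k - 1) else 0)"
    proof (cases "k \<le> a")
      case True
      then show ?thesis using k by (cases k) (auto simp: min_def)
    next
      case False
      then have "min k a = min (k - 1) a" using k by auto
      then show ?thesis using False by simp
    qed
    have "(\<Sum>n=a + partial_sum \<nu> (k - 2)..<a + partial_sum \<nu> a. f n)
        = sum f R + (\<Sum>n=a + partial_sum \<nu> (k - 1)..<a + partial_sum \<nu> a. f n)"
      unfolding R_def using mono by (intro sum.atLeastLessThan_concat[symmetric]) auto
    moreover have "k - 1 - 1 = k - 2" by simp
    ultimately show ?thesis
      unfolding T_def sum_chain_coords out in_ North by simp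
  qed
  have "(\<forall>j\<in>{2..a + 2}. (\<Sum>e\<in>out_arcs (car a \<nu>) j. ?x e) - (\<Sum>e\<in>in_arcs (car a \<nu>) j. ?x e) = 0)
      \<longleftrightarrow> (\<forall>k\<in>{1..a + 1}. T k = T (k - 1))"
  proof -
    have shift: "{2..a + 2} = (\<lambda>k. k + 1) ` {1..a + 1}"
      by (simp add: image_add_atLeastAtMost numeral_2_eq_2)
    show ?thesis
      unfolding shift ball_simps
    proof (rule ball_cong[OF refl])
      fix k assume "k \<in> {1..a + 1}"
      then have k: "1 \<le> k" "k \<le> a + 1" by auto
      show "(\<Sum>e\<in>out_arcs (car a \<nu>) (k + 1). ?x e) - (\<Sum>e\<in>in_arcs (car a \<nu>) (k + 1). ?x e) = 0
          \<longleftrightarrow> T k = T (k - 1)"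
        unfolding step[OF k] by simp
    qed
  qed
  moreover have "T 0 = 1 \<and> (\<forall>k\<in>{1..a + 1}. T k = T (k - 1)) \<longleftrightarrow> (\<forall>k\<le>a + 1. T k = 1)"
  proof
    assume *: "T 0 = 1 \<and> (\<forall>k\<in>{1..a + 1}. T k = T (k - 1))"
    have "k \<le> a + 1 \<longrightarrow> T k = 1" for k
    proof (induction k)
      case (Suc k)
      have "T (Suc k) = T k" if "Suc k \<le> a + 1"
        using * that by (auto dest!: bspec[of _ _ "Suc k"])
      with Suc show ?case by auto
    qed (use * in simp)
    then show "\<forall>k\<le>a + 1. T k = 1" by blast
  qed auto
  ultimately show ?thesis
    unfolding flow_polytope_def mem_Collect_eq source T_def[symmetric] z_def[symmetric] f_def[symmetric]
    by blast
qed

text \<open>The unit flow along the path \<open>1, 2, \<dots>, a + 3\<close>, at which all free coordinates vanish.\<close>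
definition base_flow :: "nat \<Rightarrow> arc \<Rightarrow>\<^sub>0 real" where
  "base_flow a = (\<Sum>k\<le>a + 1. Poly_Mapping.single (chain_arc k) 1)"

text \<open>
  Raising one free coordinate by \<open>1\<close> diverts one unit of flow from the arcs \<open>(k + 1, k + 2)\<close> of all the
  cuts that it crosses.
\<close>
definition coord_direction :: "nat \<Rightarrow> (nat \<Rightarrow> nat) \<Rightarrow> nat \<Rightarrow> arc \<Rightarrow>\<^sub>0 real" where
  "coord_direction a \<nu> n = Poly_Mapping.single (coord_arc a \<nu> n) 1
    - (\<Sum>k | k \<le> a + 1 \<and> n \<in> chain_coords a \<nu> k. Poly_Mapping.single (chain_arc k) 1)"

lemma lookup_sum_single_chain_arc:
  assumes "finite K"
  shows "Poly_Mapping.lookup (\<Sum>k\<in>K. Poly_Mapping.single (chain_arc k) (1::real)) e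
    = (if e \<in> chain_arc ` K then 1 else 0)"
proof (cases "e \<in> chain_arc ` K")
  case True
  then obtain j where j: "j \<in> K" "e = chain_arc j" by auto
  have "(\<Sum>k\<in>K. (1::real) when chain_arc k = e) = (\<Sum>k\<in>K. if k = j then 1 else 0)"
    using j inj_chain_arc by (intro sum.cong) (auto simp: when_def inj_eq)
  with True j assms show ?thesis by (simp add: lookup_sum lookup_single)
next
  case False
  then have "(\<Sum>k\<in>K. (1::real) when chain_arc k = e) = 0"
    by (intro sum.neutral) (auto simp: when_def)
  with False show ?thesis by (simp add: lookup_sum lookup_single)
qed

lemma lookup_base_flow:
  "Poly_Mapping.lookup (base_flow a) e = (if e \<in> chain_arc ` {..a + 1} then 1 else 0)"
  unfolding base_flow_def by (rule lookup_sum_single_chain_arc) simp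

lemma lookup_coord_direction:
  "Poly_Mapping.lookup (coord_direction a \<nu> n) e = (if e = coord_arc a \<nu> n then 1 else 0)
    - (if e \<in> chain_arc ` {k. k \<le> a + 1 \<and> n \<in> chain_coords a \<nu> k} then 1 else 0)"
proof -
  have "finite {k. k \<le> a + 1 \<and> n \<in> chain_coords a \<nu> k}" by simp
  then show ?thesis
    unfolding coord_direction_def lookup_minus lookup_sum_single_chain_arc[OF \<open>finite _\<close>]
    by (simp add: lookup_single when_def eq_commute)
qed


section \<open>The flow polytope as a chain polytope\<close>

lemma chain_coords_subset:
  "chain_coords a \<nu> k \<subseteq> {..<a + partial_sum \<nu> a}"
  by (auto simp: chain_coords_def)

lemma finite_chain_coords [simp]: "finite (chain_coords a \<nu> k)"
  by (rule finite_subset[OF chain_coords_subset]) simp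

lemma lookup_base_flow_coord_arc:
  assumes "j < a + partial_sum \<nu> a"
  shows "Poly_Mapping.lookup (base_flow a) (coord_arc a \<nu> j) = 0"
  using coord_arc_neq_chain_arc[OF assms] by (auto simp: lookup_base_flow)

lemma lookup_coord_direction_coord_arc:
  assumes "n < a + partial_sum \<nu> a" "j < a + partial_sum \<nu> a"
  shows "Poly_Mapping.lookup (coord_direction a \<nu> n) (coord_arc a \<nu> j) = (if n = j then 1 else 0)"
proof -
  have "coord_arc a \<nu> j \<notin> chain_arc ` {k. k \<le> a + 1 \<and> n \<in> chain_coords a \<nu> k}"
    using coord_arc_neq_chain_arc[OF assms(2)] by auto
  moreover have "coord_arc a \<nu> j = coord_arc a \<nu> n \<longleftrightarrow> j = n"
    using inj_on_eq_iff[OF inj_on_coord_arc[of a \<nu>], of j n] assms by simp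
  ultimately show ?thesis unfolding lookup_coord_direction by auto
qed

context
  fixes a :: nat and \<nu> :: "nat \<Rightarrow> nat" and d :: nat and flow :: "(nat \<Rightarrow> real) \<Rightarrow> arc \<Rightarrow>\<^sub>0 real"
  defines "d \<equiv> a + partial_sum \<nu> a"
    and "flow \<equiv> affine_chart d (base_flow a) (coord_direction a \<nu>)"
begin

lemma flow_coord_arc:
  assumes "j < d"
  shows "Poly_Mapping.lookup (flow t) (coord_arc a \<nu> j) = t j"
proof -
  have "(\<Sum>n<d. t n * Poly_Mapping.lookup (coord_direction a \<nu> n) (coord_arc a \<nu> j))
      = (\<Sum>n<d. if n = j then t n else 0)"
    using assms by (intro sum.cong) (auto simp: lookup_coord_direction_coord_arc d_def)
  moreover have "Poly_Mapping.lookup (base_flow a) (coord_arc a \<nu> j) = 0"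
    using assms unfolding d_def by (rule lookup_base_flow_coord_arc)
  ultimately show ?thesis
    using assms by (simp add: flow_def lookup_affine_chart)
qed

lemma flow_chain_arc:
  assumes "k \<le> a + 1"
  shows "Poly_Mapping.lookup (flow t) (chain_arc k) = 1 - (\<Sum>n\<in>chain_coords a \<nu> k. t n)"
proof -
  have "Poly_Mapping.lookup (coord_direction a \<nu> n) (chain_arc k)
      = (if n \<in> chain_coords a \<nu> k then - 1 else 0)" if "n < d" for n
  proof -
    have "chain_arc k \<noteq> coord_arc a \<nu> n"
      using coord_arc_neq_chain_arc[of n a \<nu> k] assms that by (auto simp: d_def)
    moreover have "chain_arc k \<in> chain_arc ` {k. k \<le> a + 1 \<and> n \<in> chain_coords a \<nu> k}
        \<longleftrightarrow> n \<in> chain_coords a \<nu> k"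
      using assms by (simp add: inj_image_mem_iff[OF inj_chain_arc])
    ultimately show ?thesis unfolding lookup_coord_direction by simp
  qed
  then have "(\<Sum>n<d. t n * Poly_Mapping.lookup (coord_direction a \<nu> n) (chain_arc k))
      = (\<Sum>n<d. if n \<in> chain_coords a \<nu> k then - t n else 0)"
    by (intro sum.cong) auto
  also have "\<dots> = (\<Sum>n\<in>chain_coords a \<nu> k. - t n)"
    using chain_coords_subset[of a \<nu> k] by (intro sum.mono_neutral_cong_right) (auto simp: d_def)
  finally show ?thesis
    using assms by (simp add: flow_def lookup_affine_chart lookup_base_flow sum_negf)
qed

lemma flow_other:
  assumes "e \<notin> arcs (car a \<nu>)"
  shows "Poly_Mapping.lookup (flow t) e = 0"
proof -
  have e: "e \<notin> coord_arc a \<nu> ` {..<d}" "e \<notin> chain_arc ` {..a + 1}"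
    using assms unfolding arcs_car d_def by auto
  have "Poly_Mapping.lookup (coord_direction a \<nu> n) e = 0" if "n < d" for n
  proof -
    have "e \<noteq> coord_arc a \<nu> n" "e \<notin> chain_arc ` {k. k \<le> a + 1 \<and> n \<in> chain_coords a \<nu> k}"
      using e that by auto
    then show ?thesis unfolding lookup_coord_direction by simp
  qed
  moreover have "Poly_Mapping.lookup (base_flow a) e = 0"
    using e(2) unfolding lookup_base_flow by simp
  ultimately show ?thesis
    by (simp add: flow_def lookup_affine_chart)
qed

lemma flow_in_flow_polytope:
  "flow t \<in> flow_polytope (a + 2) (car a \<nu>)
    \<longleftrightarrow> (\<forall>n<d. 0 \<le> t n) \<and> (\<forall>k\<le>a + 1. (\<Sum>n\<in>chain_coords a \<nu> k. t n) \<le> 1)"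
proof -
  have keys: "Poly_Mapping.keys (flow t) \<subseteq> arcs (car a \<nu>)"
    using flow_other[of _ t] by (auto simp: in_keys_iff)
  have sums: "(\<Sum>n\<in>chain_coords a \<nu> k. Poly_Mapping.lookup (flow t) (coord_arc a \<nu> n))
      = (\<Sum>n\<in>chain_coords a \<nu> k. t n)" for k
    using chain_coords_subset[of a \<nu> k] by (intro sum.cong) (auto simp: flow_coord_arc d_def)
  have "(\<forall>e\<in>arcs (car a \<nu>). 0 \<le> Poly_Mapping.lookup (flow t) e)
      \<longleftrightarrow> (\<forall>n<d. 0 \<le> t n) \<and> (\<forall>k\<le>a + 1. (\<Sum>n\<in>chain_coords a \<nu> k. t n) \<le> 1)"
    unfolding arcs_car d_def[symmetric] ball_Un ball_simps
    by (simp add: flow_coord_arc flow_chain_arc Ball_def)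
  then show ?thesis
    unfolding flow_polytope_car using keys by (simp add: sums flow_chain_arc)
qed

lemma flow_polytope_subset_range_flow:
  "flow_polytope (a + 2) (car a \<nu>) \<subseteq> flow ` ({..<d} \<rightarrow>\<^sub>E UNIV)"
proof
  fix x assume x: "x \<in> flow_polytope (a + 2) (car a \<nu>)"
  define t where "t = (\<lambda>n\<in>{..<d}. Poly_Mapping.lookup x (coord_arc a \<nu> n))"
  have "x = flow t"
  proof (rule poly_mapping_eqI)
    fix e
    show "Poly_Mapping.lookup x e = Poly_Mapping.lookup (flow t) e"
    proof (cases "e \<in> arcs (car a \<nu>)")
      case False
      then have "Poly_Mapping.lookup x e = 0"
        using x unfolding flow_polytope_car by (auto simp: in_keys_iff)
      with False show ?thesis by (simp add: flow_other)
    next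
      case True
      then consider n where "n < d" "e = coord_arc a \<nu> n" | k where "k \<le> a + 1" "e = chain_arc k"
        unfolding arcs_car d_def by auto
      then show ?thesis
      proof cases
        case 1
        then show ?thesis by (simp add: flow_coord_arc t_def)
      next
        case 2
        have "Poly_Mapping.lookup x (chain_arc k)
            + (\<Sum>n\<in>chain_coords a \<nu> k. Poly_Mapping.lookup x (coord_arc a \<nu> n)) = 1"
          using x 2 unfolding flow_polytope_car by blast
        moreover have "(\<Sum>n\<in>chain_coords a \<nu> k. Poly_Mapping.lookup x (coord_arc a \<nu> n))
            = (\<Sum>n\<in>chain_coords a \<nu> k. t n)"
          using chain_coords_subset[of a \<nu> k] by (intro sum.cong) (auto simp: t_def d_def)
        ultimately show ?thesis using 2 by (simp add: flow_chain_arc)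
      qed
    qed
  qed
  then show "x \<in> flow ` ({..<d} \<rightarrow>\<^sub>E UNIV)" by (auto simp: t_def)
qed

text \<open>
  Each cut sum is at most the largest sum over a chain in the poset: either the cut leaves no east
  step, and the sum is a part of the first chain, or \<open>j = N (k - 1)\<close> is the first east step beyond
  the cut, and it lies above at least the \<open>k\<close> summands of the first chain. Conversely, a maximal
  chain entering the second chain at \<open>j\<close> is dominated by the cut at the level of \<open>j\<close>.
\<close>
lemma chain_sums_le_iff_height_le:
  fixes t :: "nat \<Rightarrow> real"
  assumes t: "\<And>n. n < d \<Longrightarrow> 0 \<le> t n"
  shows "(\<forall>k\<le>a + 1. (\<Sum>n\<in>chain_coords a \<nu> k. t n) \<le> 1)
    \<longleftrightarrow> height a (east_level \<nu>) a (partial_sum \<nu> a) t \<le> 1"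
proof -
  let ?b = "partial_sum \<nu> a"
  have sum: "(\<Sum>n\<in>chain_coords a \<nu> k. t n)
      = (\<Sum>n<min k a. t n) + (\<Sum>n=partial_sum \<nu> (k - 1)..<?b. t (a + n))" for k
    unfolding sum_chain_coords
    using sum.shift_bounds_nat_ivl[of t "partial_sum \<nu> (k - 1)" a ?b] by (simp add: add.commute)
  have y_mono: "(\<Sum>n<i. t n) \<le> (\<Sum>n<j. t n)" if "i \<le> j" "j \<le> a" for i j
    using that t by (intro sum_mono2) (auto simp: d_def)
  show ?thesis
  proof
    assume le: "\<forall>k\<le>a + 1. (\<Sum>n\<in>chain_coords a \<nu> k. t n) \<le> 1"
    have "(\<Sum>n<a. t n) \<le> 1"
      using le[rule_format, of "a + 1"] by (simp add: sum)
    moreover have "x_height a (east_level \<nu>) t ?b \<le> 1"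
    proof (cases "?b = 0")
      case False
      then have "0 < ?b" by (simp only: neq0_conv)
      then have "east_level \<nu> 1 \<le> a" using east_level_bounds(2)[of 0 \<nu> a] by (simp only: One_nat_def)
      then have "\<And>i. i < east_level \<nu> 1 \<Longrightarrow> 0 \<le> t i" using t by (simp add: d_def)
      from x_height_attained[of ?b "east_level \<nu>" t a, OF \<open>0 < ?b\<close> this] obtain j where j: "j < ?b"
        "x_height a (east_level \<nu>) t ?b
          = (\<Sum>i<east_level \<nu> (Suc j). t i) + (\<Sum>i=j..<?b. t (a + i))" by blast
      define k where "k = east_level \<nu> (Suc j)"
      have k: "1 \<le> k" "k \<le> a" "partial_sum \<nu> (k - 1) \<le> j"
        using east_level_bounds[OF j(1)] by (auto simp: k_def)
      have "(\<Sum>i=j..<?b. t (a + i)) \<le> (\<Sum>i=partial_sum \<nu> (k - 1)..<?b. t (a + i))"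
        using k(3) t by (intro sum_mono2) (auto simp: d_def)
      then have "x_height a (east_level \<nu>) t ?b \<le> (\<Sum>n\<in>chain_coords a \<nu> k. t n)"
        using k(2) unfolding j(2) sum k_def[symmetric] by (simp add: min_absorb1)
      also have "\<dots> \<le> 1" using le k(2) by simp
      finally show ?thesis .
    next
      case True
      show ?thesis unfolding True by simp
    qed
    ultimately show "height a (east_level \<nu>) a ?b t \<le> 1" by (simp add: height_def)
  next
    assume "height a (east_level \<nu>) a ?b t \<le> 1"
    then have y: "(\<Sum>n<a. t n) \<le> 1" and x: "x_height a (east_level \<nu>) t ?b \<le> 1"
      by (auto simp: height_def)
    show "\<forall>k\<le>a + 1. (\<Sum>n\<in>chain_coords a \<nu> k. t n) \<le> 1"
    proof (intro allI impI)
      fix k assume "k \<le> a + 1"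
      show "(\<Sum>n\<in>chain_coords a \<nu> k. t n) \<le> 1"
      proof (cases "partial_sum \<nu> (k - 1) < ?b")
        case True
        define j where "j = partial_sum \<nu> (k - 1)"
        have "\<not> east_level \<nu> (Suc j) \<le> k - 1"
          using east_level_le_iff[of "Suc j" \<nu> a "k - 1"] True by (simp add: j_def)
        moreover have "east_level \<nu> (Suc j) \<le> a"
          using east_level_bounds(2)[of j \<nu> a] True by (simp add: j_def)
        ultimately have "(\<Sum>n<min k a. t n) \<le> (\<Sum>n<east_level \<nu> (Suc j). t n)"
          by (intro y_mono) auto
        moreover have "(\<Sum>i<east_level \<nu> (Suc j). t i) + (\<Sum>i=j..<?b. t (a + i))
            \<le> x_height a (east_level \<nu>) t ?b"
          by (rule le_x_height) (use True in \<open>simp add: j_def\<close>)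
        ultimately show ?thesis using x unfolding sum j_def by linarith
      next
        case False
        then have "(\<Sum>n\<in>chain_coords a \<nu> k. t n) = (\<Sum>n<min k a. t n)" by (simp add: sum)
        also have "\<dots> \<le> (\<Sum>n<a. t n)" by (intro y_mono) auto
        finally show ?thesis using y by simp
      qed
    qed
  qed
qed

lemma flow_coordinates_eq_two_chains:
  "{t \<in> {..<d} \<rightarrow>\<^sub>E UNIV. flow t \<in> flow_polytope (a + 2) (car a \<nu>)}
    = {t \<in> orthant (two_chains a a (partial_sum \<nu> a)). height a (east_level \<nu>) a (partial_sum \<nu> a) t \<le> 1}"
proof -
  have index: "two_chains a a (partial_sum \<nu> a) = {..<d}"
    by (auto simp: two_chains_def d_def)
  show ?thesis
    unfolding index flow_in_flow_polytope orthant_def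
    using chain_sums_le_iff_height_le by (auto simp: PiE_iff)
qed

end

theorem theorem1p1:
  fixes a b :: nat and \<nu> :: "nat \<Rightarrow> nat"
  assumes "a \<ge> 1" and "endpoint (path_of a \<nu>) = (b, a)"
  shows "normalized_volume (flow_polytope (a + 2) (car a \<nu>)) = real (Cat (path_of a \<nu>))"
proof -
  let ?P = "flow_polytope (a + 2) (car a \<nu>)" and ?b = "partial_sum \<nu> a"
  let ?flow = "affine_chart (a + ?b) (base_flow a) (coord_direction a \<nu>)"
  let ?M = "\<Pi>\<^sub>M i\<in>{..<a + ?b}. (lborel :: real measure)"
  let ?R = "{t \<in> {..<a + ?b} \<rightarrow>\<^sub>E UNIV. ?flow t \<in> ?P}"
  have index: "two_chains a a ?b = {..<a + ?b}"
    by (auto simp: two_chains_def)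
  have "emeasure ?M ?R = ennreal (real (path_count (partial_sum \<nu>) a ?b) * 1 ^ (a + ?b) / fact (a + ?b))"
    unfolding flow_coordinates_eq_two_chains unfolding index[symmetric]
    by (rule volume_two_chains[where b = ?b, OF east_level_le_iff]) simp_all
  then have volume: "measure ?M ?R = real (path_count (partial_sum \<nu>) a ?b) / fact (a + ?b)"
    by (simp add: measure_def)
  have "normalized_volume ?P = fact (a + ?b) * measure ?M ?R"
  proof (rule normalized_volume_eq_measure_in_coordinates[where e = "coord_arc a \<nu>"])
    show "base_flow a \<in> integer_lattice"
      by (simp add: integer_lattice_def lookup_base_flow)
    show "coord_direction a \<nu> i \<in> integer_lattice" for i
      by (simp add: integer_lattice_def lookup_coord_direction)
    show "Poly_Mapping.lookup (base_flow a) (coord_arc a \<nu> j) = 0" if "j < a + ?b" for j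
      using that by (rule lookup_base_flow_coord_arc)
    show "Poly_Mapping.lookup (coord_direction a \<nu> i) (coord_arc a \<nu> j) = (if i = j then 1 else 0)"
      if "i < a + ?b" "j < a + ?b" for i j
      using that by (rule lookup_coord_direction_coord_arc)
    have "base_flow a = ?flow (\<lambda>_. 0)"
      by (simp add: affine_chart_def)
    also have "\<dots> \<in> ?P"
      unfolding flow_in_flow_polytope by simp
    finally show "base_flow a \<in> ?P" .
    show "base_flow a + coord_direction a \<nu> i \<in> ?P" if "i < a + ?b" for i
    proof -
      have "base_flow a + coord_direction a \<nu> i = ?flow (\<lambda>n. if n = i then 1 else 0)"
        using that by (simp add: affine_chart_def if_distrib[of "\<lambda>c. c *\<^sub>R _"] cong: if_cong)
      also have "\<dots> \<in> ?P"
        unfolding flow_in_flow_polytope by simp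
      finally show ?thesis .
    qed
    show "?P \<subseteq> ?flow ` ({..<a + ?b} \<rightarrow>\<^sub>E UNIV)"
      by (rule flow_polytope_subset_range_flow)
    have "{t \<in> orthant (two_chains a a ?b). height a (east_level \<nu>) a ?b t \<le> 1}
        \<in> sets (\<Pi>\<^sub>M i\<in>two_chains a a ?b. lborel)"
      by (rule sets_height_le)
    then show "?R \<in> sets ?M"
      unfolding flow_coordinates_eq_two_chains index .
  qed
  also have "\<dots> = real (Cat (path_of a \<nu>))"
    unfolding volume Cat_path_of by simp
  finally show ?thesis .
qed

end
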